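(* If $\alpha>0$ is an ordinal, then $\overline{\mathbb{R}}_\alpha$ contains improper elements.
   Context: For an ordinal $\alpha$, let $\mathbb{N}_\alpha$ be the set of ordinals strictly less than $\omega^{\omega^\alpha}$ with the ordinal order and the natural (Hessenberg) sum and product. Let $\mathbb{Z}_\alpha$ be the classes of pairs $(a,b)\in\mathbb{N}_\alpha^2$ under $(a,b)\sim(c,d)\iff a+d=b+c$, with $(a,b)+(c,d)=(a+c,b+d)$, $(a,b)(c,d)=(ac+bd,ad+bc)$, order $[(a_1,a_2)]\ge[(b_1,b_2)]\iff a_1+b_2\ge a_2+b_1$. Let $\mathbb{Q}_\alpha$ be its field of fractions (classes of $(a,b)$, $b\ne0$, under $ad=bc$, usual fraction operations), a linearly ordered field with $A\ge0$ iff $ab\ge0$ for representatives and $A\ge B$ iff $A-B\ge0$; $\mathbb{Q}_\alpha^+$ denotes its positive elements. A Dedekind cut on $\mathbb{Q}_\alpha$ is a pair $(A,B)$ of subsets such that: every element of $A$ is less than every element of $B$; $\mathbb{Q}_\alpha\setminus(A\cup B)$ has at most one element; $\inf(B)\notin B$ and $\sup(A)\notin A$; $A\cap B=\varnothing$. $\overline{\mathbb{R}}_\alpha$ is the set of all Dedekind cuts on $\mathbb{Q}_\alpha$. A ball in $\mathbb{Q}_\alpha$ is a set $\{y\in\mathbb{Q}_\alpha: |x-y|<r\}$ with $x\in\mathbb{Q}_\alpha$, $r\in\mathbb{Q}_\alpha^+$. A cut $(A,B)$ is improper if there exists $d\in\mathbb{Q}_\alpha^+$ such that every ball $U$ with $U\cap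 A\ne\varnothing$ and $U\cap B\neq\varnothing$ satisfies $\sup(U)-\inf(U)>d$; otherwise it is proper. *)

theory Defs
  imports "HOL-Library.Multiset" "HOL-Library.Infinite_Typeclass"
begin

section \<open>Ordinals\<close>

text \<open>
  An ordinal is an isomorphism class of well-orders. HOL has no type of all ordinals;
  \<open>'a ordinal\<close> consists of the ordinals of cardinality at most that of \<open>'a\<close>. For infinite
  \<open>'a\<close> these are the ordinals below the successor cardinal of the cardinality of \<open>'a\<close>; they are
  closed under all operations used below (in particular \<open>\<alpha> \<mapsto> \<omega>\<^bsup>\<omega>\<^bsup>\<alpha>\<^esup>\<^esup>\<close>), so nothing is truncated.
\<close>

quotient_type 'a ordinal = "'a rel" / partial: "\<lambda>r s. (r, s) \<in> ordIso"
proof (rule part_equivpI)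
  show "\<exists>r :: 'a rel. (r, r) \<in> ordIso"
    using ordIso_reflexive[OF card_of_Well_order] by blast
  show "symp (\<lambda>r s :: 'a rel. (r, s) \<in> ordIso)"
    by (auto intro: sympI ordIso_symmetric)
  show "transp (\<lambda>r s :: 'a rel. (r, s) \<in> ordIso)"
    by (auto intro: transpI ordIso_transitive)
qed

instantiation ordinal :: (type) wellorder
begin

lift_definition less_eq_ordinal :: "'a ordinal \<Rightarrow> 'a ordinal \<Rightarrow> bool"
  is "\<lambda>r s. (r, s) \<in> ordLeq"
  by (meson ordIso_ordLeq_trans ordIso_symmetric ordLeq_ordIso_trans)

lift_definition less_ordinal :: "'a ordinal \<Rightarrow> 'a ordinal \<Rightarrow> bool"
  is "\<lambda>r s. (r, s) \<in> ordLess"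
  by (meson ordIso_ordLess_trans ordIso_symmetric ordLess_ordIso_trans)

instance
proof
  fix x y z :: "'a ordinal"
  show "x < y \<longleftrightarrow> x \<le> y \<and> \<not> y \<le> x"
    by transfer
      (metis not_ordLess_ordLeq ordIso_iff_ordLeq ordLeq_iff_ordLess_or_ordIso)
  show "x \<le> x"
    by transfer (simp add: ordIso_imp_ordLeq)
  show "x \<le> y \<Longrightarrow> y \<le> z \<Longrightarrow> x \<le> z"
    by transfer (rule ordLeq_transitive)
  show "x \<le> y \<Longrightarrow> y \<le> x \<Longrightarrow> x = y"
    by transfer (simp add: ordIso_iff_ordLeq)
  show "x \<le> y \<or> y \<le> x"
    by transfer (meson ordIso_iff_ordLeq ordLeq_Well_order_simp ordLeq_total)
next
  fix P :: "'a ordinal \<Rightarrow> bool" and a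
  assume step: "\<And>x. (\<And>y. y < x \<Longrightarrow> P y) \<Longrightarrow> P x"
  have "wfp ((<) :: 'a ordinal \<Rightarrow> _)"
  proof -
    have "{(x, y). x < y} \<subseteq> inv_image ordLess (rep_ordinal :: 'a ordinal \<Rightarrow> _)"
      by (auto simp: less_ordinal.rep_eq)
    then show ?thesis
      unfolding wfp_def by (rule wf_subset[OF wf_inv_image[OF wf_ordLess]])
  qed
  then show "P a"
    using step by (rule wfp_induct_rule)
qed

end

instantiation ordinal :: (type) zero
begin
lift_definition zero_ordinal :: "'a ordinal" is "{}"
  by (simp add: ordIso_reflexive)
instance ..
end

definition osuc :: "'a ordinal \<Rightarrow> 'a ordinal" where
  "osuc a = (LEAST c. a < c)"

definition osup :: "'a ordinal set \<Rightarrow> 'a ordinal" where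
  "osup S = (LEAST c. \<forall>x\<in>S. x \<le> c)"

text \<open>
  The usual recursions with the zero, successor and limit clauses merged:
  \<open>a + b = sup ({a} \<union> {(a + c) + 1 | c < b})\<close>, \<open>a \<cdot> b = sup {a \<cdot> c + a | c < b}\<close>,
  \<open>\<omega>\<^bsup>b\<^esup> = sup ({1} \<union> {\<omega>\<^bsup>c\<^esup> \<cdot> \<omega> | c < b})\<close>.
\<close>

function oadd :: "'a ordinal \<Rightarrow> 'a ordinal \<Rightarrow> 'a ordinal" where
  "oadd a b = osup (insert a ((\<lambda>c. osuc (oadd a c)) ` {..<b}))"
  by auto
termination
  by (relation "inv_image {(x, y). x < y} snd") (auto simp: wf)

declare oadd.simps [simp del]

function omult :: "'a ordinal \<Rightarrow> 'a ordinal \<Rightarrow> 'a ordinal" where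
  "omult a b = osup ((\<lambda>c. oadd (omult a c) a) ` {..<b})"
  by auto
termination
  by (relation "inv_image {(x, y). x < y} snd") (auto simp: wf)

declare omult.simps [simp del]

text \<open>The least ordinal which is nonzero and closed under successors.\<close>

definition omega :: "'a ordinal" where
  "omega = (LEAST c. 0 < c \<and> (\<forall>a<c. osuc a < c))"

function omega_pow :: "'a ordinal \<Rightarrow> 'a ordinal" where
  "omega_pow b = osup (insert (osuc 0) ((\<lambda>c. omult (omega_pow c) omega) ` {..<b}))"
  by auto
termination
  by (relation "{(x, y). x < y}") (auto simp: wf)

declare omega_pow.simps [simp del]


section \<open>Natural (Hessenberg) sum and product\<close>

text \<open>
  A Cantor normal form \<open>\<omega>\<^bsup>\<beta>\<^sub>1\<^esup> + \<dots> + \<omega>\<^bsup>\<beta>\<^sub>k\<^esup>\<close> with \<open>\<beta>\<^sub>1 \<ge> \<dots> \<ge> \<beta>\<^sub>k\<close> is represented by the finite multiset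
  of its exponents.
\<close>

definition cnf_val :: "'a ordinal multiset \<Rightarrow> 'a ordinal" where
  "cnf_val M = foldr (\<lambda>b s. oadd (omega_pow b) s) (rev (sorted_list_of_multiset M)) 0"

definition cnf :: "'a ordinal \<Rightarrow> 'a ordinal multiset" where
  "cnf a = (THE M. cnf_val M = a)"

definition nat_sum :: "'a ordinal \<Rightarrow> 'a ordinal \<Rightarrow> 'a ordinal" (infixl \<open>\<oplus>\<close> 65) where
  "a \<oplus> b = cnf_val (cnf a + cnf b)"

definition nat_prod :: "'a ordinal \<Rightarrow> 'a ordinal \<Rightarrow> 'a ordinal" (infixl \<open>\<otimes>\<close> 70) where
  "a \<otimes> b = cnf_val (\<Sum>x\<in>#cnf a. {#x \<oplus> y. y \<in># cnf b#})"

definition N_car :: "'a ordinal \<Rightarrow> 'a ordinal set" where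
  "N_car \<alpha> = {x. x < omega_pow (omega_pow \<alpha>)}"


section \<open>The ring \<open>\<int>\<^sub>\<alpha>\<close>\<close>

type_synonym 'a zord = "('a ordinal \<times> 'a ordinal) set"

definition Z_rel :: "'a ordinal \<Rightarrow> ('a ordinal \<times> 'a ordinal) rel" where
  "Z_rel \<alpha> = {((a, b), (c, d)) | a b c d.
     a \<in> N_car \<alpha> \<and> b \<in> N_car \<alpha> \<and> c \<in> N_car \<alpha> \<and> d \<in> N_car \<alpha> \<and> a \<oplus> d = b \<oplus> c}"

definition Z_car :: "'a ordinal \<Rightarrow> 'a zord set" where
  "Z_car \<alpha> = (N_car \<alpha> \<times> N_car \<alpha>) // Z_rel \<alpha>"

definition Z_class :: "'a ordinal \<Rightarrow> 'a ordinal \<Rightarrow> 'a ordinal \<Rightarrow> 'a zord" where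
  "Z_class \<alpha> a b = Z_rel \<alpha> `` {(a, b)}"

definition Z_zero :: "'a ordinal \<Rightarrow> 'a zord" where
  "Z_zero \<alpha> = Z_class \<alpha> 0 0"

text \<open>Operations on classes: the union over all representatives of the resulting (equal) classes.\<close>

definition Z_add :: "'a ordinal \<Rightarrow> 'a zord \<Rightarrow> 'a zord \<Rightarrow> 'a zord" where
  "Z_add \<alpha> X Y = (\<Union>(a, b)\<in>X. \<Union>(c, d)\<in>Y. Z_class \<alpha> (a \<oplus> c) (b \<oplus> d))"

definition Z_mult :: "'a ordinal \<Rightarrow> 'a zord \<Rightarrow> 'a zord \<Rightarrow> 'a zord" where
  "Z_mult \<alpha> X Y = (\<Union>(a, b)\<in>X. \<Union>(c, d)\<in>Y.
     Z_class \<alpha> (a \<otimes> c \<oplus> b \<otimes> d) (a \<otimes> d \<oplus> b \<otimes> c))"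

definition Z_neg :: "'a ordinal \<Rightarrow> 'a zord \<Rightarrow> 'a zord" where
  "Z_neg \<alpha> X = (\<Union>(a, b)\<in>X. Z_class \<alpha> b a)"

definition Z_le :: "'a zord \<Rightarrow> 'a zord \<Rightarrow> bool" where
  "Z_le Y X \<longleftrightarrow> (\<exists>(a1, a2)\<in>X. \<exists>(b1, b2)\<in>Y. a1 \<oplus> b2 \<ge> a2 \<oplus> b1)"


section \<open>The field \<open>\<rat>\<^sub>\<alpha>\<close>\<close>

type_synonym 'a qord = "('a zord \<times> 'a zord) set"

definition Q_pairs :: "'a ordinal \<Rightarrow> ('a zord \<times> 'a zord) set" where
  "Q_pairs \<alpha> = Z_car \<alpha> \<times> (Z_car \<alpha> - {Z_zero \<alpha>})"

definition Q_rel :: "'a ordinal \<Rightarrow> ('a zord \<times> 'a zord) rel" where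
  "Q_rel \<alpha> = {((a, b), (c, d)) | a b c d.
     (a, b) \<in> Q_pairs \<alpha> \<and> (c, d) \<in> Q_pairs \<alpha> \<and> Z_mult \<alpha> a d = Z_mult \<alpha> b c}"

definition Q_car :: "'a ordinal \<Rightarrow> 'a qord set" where
  "Q_car \<alpha> = Q_pairs \<alpha> // Q_rel \<alpha>"

definition Q_class :: "'a ordinal \<Rightarrow> 'a zord \<Rightarrow> 'a zord \<Rightarrow> 'a qord" where
  "Q_class \<alpha> a b = Q_rel \<alpha> `` {(a, b)}"

definition Q_zero :: "'a ordinal \<Rightarrow> 'a qord" where
  "Q_zero \<alpha> = Q_class \<alpha> (Z_zero \<alpha>) (Z_class \<alpha> (osuc 0) 0)"

definition Q_add :: "'a ordinal \<Rightarrow> 'a qord \<Rightarrow> 'a qord \<Rightarrow> 'a qord" where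
  "Q_add \<alpha> A B = (\<Union>(a, b)\<in>A. \<Union>(c, d)\<in>B.
     Q_class \<alpha> (Z_add \<alpha> (Z_mult \<alpha> a d) (Z_mult \<alpha> b c)) (Z_mult \<alpha> b d))"

definition Q_neg :: "'a ordinal \<Rightarrow> 'a qord \<Rightarrow> 'a qord" where
  "Q_neg \<alpha> A = (\<Union>(a, b)\<in>A. Q_class \<alpha> (Z_neg \<alpha> a) b)"

definition Q_diff :: "'a ordinal \<Rightarrow> 'a qord \<Rightarrow> 'a qord \<Rightarrow> 'a qord" where
  "Q_diff \<alpha> A B = Q_add \<alpha> A (Q_neg \<alpha> B)"

definition Q_nonneg :: "'a ordinal \<Rightarrow> 'a qord \<Rightarrow> bool" where
  "Q_nonneg \<alpha> A \<longleftrightarrow> (\<exists>(a, b)\<in>A. Z_le (Z_zero \<alpha>) (Z_mult \<alpha> a b))"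

definition Q_le :: "'a ordinal \<Rightarrow> 'a qord \<Rightarrow> 'a qord \<Rightarrow> bool" where
  "Q_le \<alpha> B A \<longleftrightarrow> Q_nonneg \<alpha> (Q_diff \<alpha> A B)"

definition Q_less :: "'a ordinal \<Rightarrow> 'a qord \<Rightarrow> 'a qord \<Rightarrow> bool" where
  "Q_less \<alpha> A B \<longleftrightarrow> Q_le \<alpha> A B \<and> A \<noteq> B"

definition Q_pos :: "'a ordinal \<Rightarrow> 'a qord set" where
  "Q_pos \<alpha> = {A \<in> Q_car \<alpha>. Q_less \<alpha> (Q_zero \<alpha>) A}"

definition Q_abs :: "'a ordinal \<Rightarrow> 'a qord \<Rightarrow> 'a qord" where
  "Q_abs \<alpha> A = (if Q_nonneg \<alpha> A then A else Q_neg \<alpha> A)"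

text \<open>\<open>s\<close> is the supremum (infimum) of \<open>S\<close> in \<open>\<rat>\<^sub>\<alpha>\<close>, which need not exist.\<close>

definition is_Q_sup :: "'a ordinal \<Rightarrow> 'a qord set \<Rightarrow> 'a qord \<Rightarrow> bool" where
  "is_Q_sup \<alpha> S s \<longleftrightarrow> s \<in> Q_car \<alpha> \<and> (\<forall>x\<in>S. Q_le \<alpha> x s) \<and>
     (\<forall>u\<in>Q_car \<alpha>. (\<forall>x\<in>S. Q_le \<alpha> x u) \<longrightarrow> Q_le \<alpha> s u)"

definition is_Q_inf :: "'a ordinal \<Rightarrow> 'a qord set \<Rightarrow> 'a qord \<Rightarrow> bool" where
  "is_Q_inf \<alpha> S i \<longleftrightarrow> i \<in> Q_car \<alpha> \<and> (\<forall>x\<in>S. Q_le \<alpha> i x) \<and>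
     (\<forall>l\<in>Q_car \<alpha>. (\<forall>x\<in>S. Q_le \<alpha> l x) \<longrightarrow> Q_le \<alpha> l i)"


section \<open>Dedekind cuts\<close>

text \<open>
  The set of all Dedekind cuts on \<open>\<rat>\<^sub>\<alpha>\<close>. The conditions \<open>sup A \<notin> A\<close> and \<open>inf B \<notin> B\<close> say that no
  element of \<open>A\<close> is a supremum of \<open>A\<close> and no element of \<open>B\<close> is an infimum of \<open>B\<close>; in particular they
  hold if the supremum or infimum does not exist. The definition does not exclude the degenerate
  cuts with an empty side.
\<close>

definition R_bar :: "'a ordinal \<Rightarrow> ('a qord set \<times> 'a qord set) set" where
  "R_bar \<alpha> = {(A, B). A \<subseteq> Q_car \<alpha> \<and> B \<subseteq> Q_car \<alpha> \<and>
     (\<forall>a\<in>A. \<forall>b\<in>B. Q_less \<alpha> a b) \<and>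
     (\<forall>x\<in>Q_car \<alpha> - (A \<union> B). \<forall>y\<in>Q_car \<alpha> - (A \<union> B). x = y) \<and>
     (\<forall>i. is_Q_inf \<alpha> B i \<longrightarrow> i \<notin> B) \<and> (\<forall>s. is_Q_sup \<alpha> A s \<longrightarrow> s \<notin> A) \<and>
     A \<inter> B = {}}"

definition Q_ball :: "'a ordinal \<Rightarrow> 'a qord \<Rightarrow> 'a qord \<Rightarrow> 'a qord set" where
  "Q_ball \<alpha> x r = {y \<in> Q_car \<alpha>. Q_less \<alpha> (Q_abs \<alpha> (Q_diff \<alpha> x y)) r}"

definition is_Q_ball :: "'a ordinal \<Rightarrow> 'a qord set \<Rightarrow> bool" where
  "is_Q_ball \<alpha> U \<longleftrightarrow> (\<exists>x\<in>Q_car \<alpha>. \<exists>r\<in>Q_pos \<alpha>. U = Q_ball \<alpha> x r)"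

definition improper :: "'a ordinal \<Rightarrow> 'a qord set \<times> 'a qord set \<Rightarrow> bool" where
  "improper \<alpha> C \<longleftrightarrow> (\<exists>d\<in>Q_pos \<alpha>. \<forall>U. is_Q_ball \<alpha> U \<and> U \<inter> fst C \<noteq> {} \<and> U \<inter> snd C \<noteq> {} \<longrightarrow>
     (\<exists>s i. is_Q_sup \<alpha> U s \<and> is_Q_inf \<alpha> U i \<and> Q_less \<alpha> d (Q_diff \<alpha> s i)))"

end

theory Submission
  imports Defs "HOL-Library.Multiset_Order" "HOL-Computational_Algebra.Fraction_Field"
begin

text \<open>
  For \<open>\<alpha> > 0\<close> the field \<open>\<rat>\<^sub>\<alpha>\<close> contains \<open>\<omega>\<close>, so it is non-archimedean and the cut between the elements
  below some natural number and the upper bounds of the naturals is nontrivial. Both sides are stable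
  under translation by 1, so neither contains its supremum or infimum, and a ball meeting both sides
  has diameter greater than 1.

  That \<open>\<rat>\<^sub>\<alpha>\<close> is an ordered field rests on Cantor normal forms being an order isomorphism from finite
  multisets of ordinals, under the multiset order, onto the ordinals: it turns natural sum and product
  into multiset union and convolution of multisets.
\<close>

section \<open>Regularity of the type of ordinals\<close>

unbundle cardinal_syntax

text \<open>Two obstacles shape the proof. The recursions take suprema by \<open>LEAST\<close>,
  which says something only where an upper bound exists, and \<open>'a ordinal\<close> is a
  set-sized stand-in for the class of all ordinals. Hence the type has to be shown regular: a set of
  at most as many ordinals as \<open>'a\<close> has elements is bounded. Initial segments
  \<open>{..<x}\<close> are that small, and so are countable sets when \<open>'a\<close> is
  infinite. The second obstacle is that the ring and the field are sets of classes, with operations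
  that are unions over representatives. Instead of checking field laws on carriers, the ring of
  differences and its fraction field are built as types over all of \<open>'a ordinal\<close>, where
  type classes supply the laws; the structures for \<alpha> are images of the subsets
  \<open>Z_dom\<close> and \<open>Q_dom\<close> under maps compatible with operations and order. The
  multiset order enters because normal forms are compared lexicographically from the largest
  exponent down, which for multisets over a linear order is exactly that order.\<close>

lemma Well_order_rep_ordinal: "Well_order (rep_ordinal x)"
proof -
  have "rep_ordinal x =o rep_ordinal x"
    by (rule Quotient3_rep_reflp[OF Quotient3_ordinal])
  then show ?thesis
    unfolding ordIso_def by blast
qed

lemma abs_ordinal_le_iff: "Well_order r \<Longrightarrow> Well_order s \<Longrightarrow> abs_ordinal r \<le> abs_ordinal s \<longleftrightarrow> r \<le>o s"
  by (simp add: less_eq_ordinal.abs_eq ordIso_reflexive)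

lemma abs_ordinal_less_iff: "Well_order r \<Longrightarrow> Well_order s \<Longrightarrow> abs_ordinal r < abs_ordinal s \<longleftrightarrow> r <o s"
  by (simp add: less_ordinal.abs_eq ordIso_reflexive)

lemma abs_rep_ordinal: "abs_ordinal (rep_ordinal x) = x"
  by (rule Quotient3_abs_rep[OF Quotient3_ordinal])

lemma abs_ordinal_eqI: "r =o s \<Longrightarrow> abs_ordinal r = abs_ordinal s"
  using Quotient3_rel_abs[OF Quotient3_ordinal] .

definition initial_type :: "'a ordinal \<Rightarrow> 'a \<Rightarrow> 'a ordinal" where
  "initial_type x a = abs_ordinal (Restr (rep_ordinal x) (underS (rep_ordinal x) a))"

text \<open>An ordinal is the order type of the ordinals below it. Initial segments of one
  well-order compare as ordinals the way they compare by inclusion, and every smaller well-order is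
  isomorphic to a proper initial segment.\<close>

lemma initial_type_bij_betw:
  "bij_betw (initial_type x) (Field (rep_ordinal x)) {..<x}"
  and initial_type_le_iff:
  "a \<in> Field (rep_ordinal x) \<Longrightarrow> b \<in> Field (rep_ordinal x) \<Longrightarrow>
    initial_type x a \<le> initial_type x b \<longleftrightarrow> (a, b) \<in> rep_ordinal x"
proof -
  let ?r = "rep_ordinal x"
  have W: "Well_order ?r"
    by (rule Well_order_rep_ordinal)
  then interpret wo: wo_rel ?r
    by (simp add: wo_rel_def)
  have WR: "Well_order (Restr ?r A)" for A
    using W by (rule Well_order_Restr)
  have le: "initial_type x a \<le> initial_type x b \<longleftrightarrow> (a, b) \<in> ?r"
    if "a \<in> Field ?r" "b \<in> Field ?r" for a b
  proof -
    have "initial_type x a \<le> initial_type x b \<longleftrightarrow> underS ?r a \<subseteq> underS ?r b"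
      unfolding initial_type_def using ofilter_subset_ordLeq[OF W, of "underS ?r a" "underS ?r b"]
      by (simp add: abs_ordinal_le_iff WR wo.underS_ofilter)
    also have "\<dots> \<longleftrightarrow> (a, b) \<in> ?r"
    proof
      assume "(a, b) \<in> ?r"
      then show "underS ?r a \<subseteq> underS ?r b"
        by (rule underS_incr[OF wo.TRANS wo.ANTISYM])
    next
      assume "underS ?r a \<subseteq> underS ?r b"
      then show "(a, b) \<in> ?r"
        using underS_incl_iff[OF wo.LIN] that by blast
    qed
    finally show ?thesis .
  qed
  then show "a \<in> Field ?r \<Longrightarrow> b \<in> Field ?r \<Longrightarrow>
    initial_type x a \<le> initial_type x b \<longleftrightarrow> (a, b) \<in> rep_ordinal x" .
  have "inj_on (initial_type x) (Field ?r)"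
  proof (rule inj_onI)
    fix a b assume "a \<in> Field ?r" "b \<in> Field ?r" "initial_type x a = initial_type x b"
    then have "(a, b) \<in> ?r" "(b, a) \<in> ?r"
      using le by force+
    then show "a = b"
      by (rule antisymD[OF wo.ANTISYM])
  qed
  moreover have "initial_type x ` Field ?r = {..<x}"
  proof safe
    fix a assume "a \<in> Field ?r"
    then have "Restr ?r (underS ?r a) <o ?r"
      using underS_Restr_ordLess[OF W] by blast
    then have "initial_type x a < abs_ordinal ?r"
      unfolding initial_type_def by (simp add: abs_ordinal_less_iff WR W)
    then show "initial_type x a < x"
      by (simp add: abs_rep_ordinal)
  next
    fix y assume "y < x"
    then have "rep_ordinal y <o ?r"
      by (simp add: less_ordinal.rep_eq)
    then obtain a where a: "a \<in> Field ?r" "rep_ordinal y =o Restr ?r (underS ?r a)"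
      using ordLess_iff_ordIso_Restr[OF W Well_order_rep_ordinal] by blast
    then have "y = initial_type x a"
      unfolding initial_type_def by (metis abs_ordinal_eqI abs_rep_ordinal)
    with a show "y \<in> initial_type x ` Field ?r"
      by blast
  qed
  ultimately show "bij_betw (initial_type x) (Field ?r) {..<x}"
    by (simp add: bij_betw_def)
qed

text \<open>The size bound under which \<open>osup\<close> is a genuine supremum.\<close>

definition small :: "'a ordinal set \<Rightarrow> bool" where
  "small S \<longleftrightarrow> |S| \<le>o |UNIV :: 'a set|"

lemma small_lessThan: "small {..<x}"
proof -
  have "|{..<x}| \<le>o |Field (rep_ordinal x)|"
    using initial_type_bij_betw[of x]
    by (metis bij_betw_imp_surj_on card_of_image)
  also have "|Field (rep_ordinal x)| \<le>o |UNIV :: 'a set|"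
    by (rule card_of_mono1) simp
  finally show ?thesis
    unfolding small_def .
qed

lemma small_image: "small S \<Longrightarrow> small (f ` S)" for f :: "'a ordinal \<Rightarrow> 'a ordinal"
  unfolding small_def by (rule ordLeq_transitive[OF card_of_image])

lemma small_range_nat: "small (range f)" for f :: "nat \<Rightarrow> 'a::infinite ordinal"
  unfolding small_def
  by (rule ordLeq_transitive[OF card_of_image]) (simp flip: infinite_iff_card_of_nat add: infinite_UNIV)

lemma small_Un: "small S \<Longrightarrow> small T \<Longrightarrow> small (S \<union> T)" for S :: "'a::infinite ordinal set"
  unfolding small_def
  by (rule card_of_Un_ordLeq_infinite_Field[where r = "|UNIV|"])
    (simp_all add: infinite_UNIV Field_card_of card_of_card_order_on)

lemma small_singleton: "small {x}"
  unfolding small_def by (rule card_of_singl_ordLeq) simp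

lemma small_insert: "small S \<Longrightarrow> small (insert x S)" for x :: "'a::infinite ordinal"
  by (metis insert_is_Un small_Un small_singleton)

text \<open>Burali-Forti: a copy on \<open>'a\<close> of the well-order of all ordinals would itself be an ordinal \<open>x\<close>,
  isomorphic to its proper initial segment \<open>{..<x}\<close>.\<close>

lemma not_small_UNIV: "\<not> small (UNIV :: 'a ordinal set)"
proof
  assume "small (UNIV :: 'a ordinal set)"
  then obtain f :: "'a ordinal \<Rightarrow> 'a" where f: "inj f"
    unfolding small_def card_of_ordLeq[symmetric] by auto
  define W :: "'a ordinal rel" where "W = {(x, y). x \<le> y}"
  have FW: "Field W = UNIV"
    by (auto simp: W_def Field_def)
  have "wf (W - Id)"
    by (rule wf_subset[OF wf]) (auto simp: W_def)
  then have W: "Well_order W"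
    unfolding well_order_on_def linear_order_on_def partial_order_on_def preorder_on_def
    using FW by (auto simp: W_def refl_on_def trans_def antisym_def total_on_def)
  define x where "x = abs_ordinal (dir_image W f)"
  have r: "Well_order (dir_image W f)" "W =o dir_image W f"
    using Well_order_dir_image[OF W] dir_image_ordIso[OF W] f by (simp_all add: FW)
  let ?r = "rep_ordinal x"
  have "?r =o dir_image W f"
    unfolding x_def by (rule rep_abs_rsp_left[OF Quotient3_ordinal ordIso_reflexive[OF r(1)]])
  then have 1: "?r =o W"
    using r(2) ordIso_symmetric ordIso_transitive by blast
  have u: "underS W x = {..<x}"
    by (auto simp: underS_def W_def)
  have FR: "Field (Restr W {..<x}) = {..<x}"
    by (auto simp: W_def Field_def)
  have "iso ?r (Restr W {..<x}) (initial_type x)"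
    unfolding iso_iff2 FR
  proof (intro conjI ballI initial_type_bij_betw)
    fix a b assume ab: "a \<in> Field ?r" "b \<in> Field ?r"
    then have "initial_type x a < x" "initial_type x b < x"
      using initial_type_bij_betw[of x] by (auto simp: bij_betw_def)
    then show "(a, b) \<in> ?r \<longleftrightarrow> (initial_type x a, initial_type x b) \<in> Restr W {..<x}"
      using initial_type_le_iff[OF ab] by (simp add: W_def)
  qed
  then have "?r =o Restr W {..<x}"
    unfolding ordIso_def using Well_order_Restr[OF W] Well_order_rep_ordinal by blast
  moreover have "Restr W {..<x} <o W"
    using underS_Restr_ordLess[OF W, of x] FW by (simp add: u)
  ultimately have "?r <o W"
    by (rule ordIso_ordLess_trans)
  with 1 show False
    using not_ordLess_ordIso by blast
qed

text \<open>Regularity of a successor cardinal: an unbounded small set would cover the type by at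
  most \<open>'a\<close> many initial segments, each small, and the whole type would be
  small.\<close>

lemma small_bounded: "small S \<Longrightarrow> \<exists>u. \<forall>x\<in>S. x < u" for S :: "'a::infinite ordinal set"
proof (rule ccontr)
  assume S: "small S" and "\<nexists>u. \<forall>x\<in>S. x < u"
  then have "UNIV = (\<Union>x\<in>S. {..x})"
    by (auto simp: not_less)
  moreover have "|{..x}| \<le>o |UNIV :: 'a set|" for x :: "'a ordinal"
  proof -
    have "{..x} = insert x {..<x}" by auto
    then show ?thesis
      using small_insert[OF small_lessThan] unfolding small_def by metis
  qed
  then have "|\<Union>x\<in>S. {..x}| \<le>o |UNIV :: 'a set|"
    using S card_of_UNION_ordLeq_infinite[OF infinite_UNIV] unfolding small_def by blast
  ultimately show False
    using not_small_UNIV unfolding small_def by metis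
qed

lemma zero_le_ordinal [simp]: "(0 :: 'a ordinal) \<le> x"
proof -
  have "({} :: 'a rel) \<le>o r" if "Well_order r" for r :: "'a rel"
    using that by (auto simp: ordLeq_def embed_def intro!: exI)
  then show ?thesis
    using abs_ordinal_le_iff[of "{}" "rep_ordinal x"] Well_order_rep_ordinal[of x]
    by (simp add: zero_ordinal.abs_eq abs_rep_ordinal)
qed

unbundle no cardinal_syntax

section \<open>Ordinal arithmetic\<close>

lemma not_less_zero_ordinal [simp]: "\<not> x < (0 :: 'a ordinal)"
  by (simp add: not_less)

lemma zero_less_ordinal_iff: "0 < x \<longleftrightarrow> x \<noteq> (0 :: 'a ordinal)"
  by (metis zero_le_ordinal le_less less_irrefl)

lemma less_osuc_iff [simp]: "x < osuc y \<longleftrightarrow> x \<le> y" for x y :: "'a::infinite ordinal"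
proof -
  have "\<exists>c. y < c"
    using small_bounded[OF small_singleton[of y]] by auto
  then have "y < osuc y"
    unfolding osuc_def by (rule LeastI_ex)
  moreover have "osuc y \<le> x" if "y < x"
    unfolding osuc_def using that by (rule Least_le)
  ultimately show ?thesis
    by (meson le_less_trans not_le)
qed

lemma osuc_le_iff [simp]: "osuc y \<le> x \<longleftrightarrow> y < x" for x y :: "'a::infinite ordinal"
  by (meson less_osuc_iff not_le)

lemma less_osup_iff: "small S \<Longrightarrow> x < osup S \<longleftrightarrow> (\<exists>s\<in>S. x < s)" for x :: "'a::infinite ordinal"
proof -
  assume "small S"
  then have "\<exists>c. \<forall>s\<in>S. s \<le> c"
    using small_bounded by (meson less_imp_le)
  then have "\<forall>s\<in>S. s \<le> osup S"
    unfolding osup_def by (rule LeastI_ex)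
  moreover have "osup S \<le> x" if "\<forall>s\<in>S. s \<le> x"
    unfolding osup_def using that by (rule Least_le)
  ultimately show ?thesis
    by (meson less_le_trans not_le)
qed

context
  fixes a b c d x y :: "'a::infinite ordinal"
begin

text \<open>Describing what lies below a sum replaces the recursion from here on. The dual
  \<open>oadd_le_iff\<close> describes upper bounds, and equations between sums are proved by
  comparing the upper bounds of both sides.\<close>

lemma less_oadd_iff: "y < oadd a b \<longleftrightarrow> y < a \<or> (\<exists>c<b. y \<le> oadd a c)"
  by (subst oadd.simps) (auto simp: less_osup_iff small_insert small_image small_lessThan)

lemma oadd_le_iff: "oadd a b \<le> y \<longleftrightarrow> a \<le> y \<and> (\<forall>c<b. oadd a c < y)"
  using less_oadd_iff by (meson not_le)

lemma less_omult_iff: "y < omult a b \<longleftrightarrow> (\<exists>c<b. y < oadd (omult a c) a)"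
  by (subst omult.simps) (auto simp: less_osup_iff small_image small_lessThan)

end

lemma oadd_strict_mono: "c < b \<Longrightarrow> oadd a c < oadd a b" for a b :: "'a::infinite ordinal"
  using less_oadd_iff by blast

lemma oadd_less_cancel_left [simp]: "oadd a c < oadd a b \<longleftrightarrow> c < b"
  for a b :: "'a::infinite ordinal"
  by (rule strict_mono_less[OF strict_monoI[OF oadd_strict_mono]])

lemma oadd_le_cancel_left [simp]: "oadd a c \<le> oadd a b \<longleftrightarrow> c \<le> b"
  for a b :: "'a::infinite ordinal"
  by (simp flip: not_less)

lemma oadd_0_right [simp]: "oadd a 0 = a" for a :: "'a::infinite ordinal"
  using less_oadd_iff[of _ a 0] by (auto simp: not_less intro!: order_antisym leI)

lemma le_oadd_left [simp]: "a \<le> oadd a b" for a :: "'a::infinite ordinal"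
  using oadd_le_iff by blast

lemma oadd_mono_left: "a \<le> a' \<Longrightarrow> oadd a b \<le> oadd a' b" for a :: "'a::infinite ordinal"
proof (induction b rule: less_induct)
  case (less b)
  have "oadd a c < oadd a' b" if "c < b" for c
    using less.IH[OF that less.prems] oadd_strict_mono[OF that] by (rule le_less_trans)
  moreover have "a \<le> oadd a' b"
    using less.prems le_oadd_left by (rule order_trans)
  ultimately show ?case
    by (simp add: oadd_le_iff[of a])
qed

lemma oadd_0_left [simp]: "oadd 0 b = b" for b :: "'a::infinite ordinal"
proof (induction b rule: less_induct)
  case (less b)
  have "oadd 0 b \<le> y \<longleftrightarrow> b \<le> y" for y
    using less by (auto simp: oadd_le_iff[of _ b] intro: less_le_trans leI)
  then show ?case
    by (metis order_antisym order_refl)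
qed

lemma le_oadd_right [simp]: "b \<le> oadd a b" for b :: "'a::infinite ordinal"
  using oadd_mono_left[of 0 a b] by simp

lemma oadd_assoc: "oadd (oadd a b) c = oadd a (oadd b c)" for a :: "'a::infinite ordinal"
proof (induction c rule: less_induct)
  case (less c)
  have "oadd (oadd a b) c \<le> y \<longleftrightarrow> oadd a (oadd b c) \<le> y" for y
  proof -
    have "oadd (oadd a b) c \<le> y \<longleftrightarrow> a \<le> y \<and> (\<forall>e<b. oadd a e < y) \<and> (\<forall>d<c. oadd a (oadd b d) < y)"
      using less by (simp add: oadd_le_iff[of _ c] oadd_le_iff[of _ b])
    also have "\<dots> \<longleftrightarrow> a \<le> y \<and> (\<forall>f < oadd b c. oadd a f < y)"
      unfolding less_oadd_iff[of _ b c]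
      by (metis oadd_le_cancel_left order_refl le_less_trans)
    finally show ?thesis
      by (simp add: oadd_le_iff)
  qed
  then show ?case
    by (metis order_antisym order_refl)
qed

text \<open>Left subtraction. For the least \<open>c\<close> with \<open>y \<le> oadd a c\<close>,
  minimality puts \<open>oadd a d\<close> below \<open>y\<close> for every \<open>d < c\<close>,
  which bounds \<open>oadd a c\<close> by \<open>y\<close>.\<close>

lemma le_imp_oadd: "a \<le> y \<Longrightarrow> \<exists>c. y = oadd a c" for a y :: "'a::infinite ordinal"
proof -
  assume "a \<le> y"
  define c where "c = (LEAST c. y \<le> oadd a c)"
  have "y \<le> oadd a c"
    unfolding c_def by (rule LeastI[of _ y]) simp
  moreover have "oadd a c \<le> y"
    unfolding oadd_le_iff using \<open>a \<le> y\<close> not_less_Least[where P = "\<lambda>c. y \<le> oadd a c"]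
    by (auto simp: c_def not_le)
  ultimately show ?thesis
    by force
qed

section \<open>Finite multiples, omega and powers of omega\<close>

fun otimes :: "nat \<Rightarrow> 'a ordinal \<Rightarrow> 'a ordinal" where
  "otimes 0 a = 0"
| "otimes (Suc n) a = oadd (otimes n a) a"

lemma otimes_mono_right: "a \<le> b \<Longrightarrow> otimes n a \<le> otimes n b" for a :: "'a::infinite ordinal"
  by (induction n) (auto intro: order_trans[OF oadd_mono_left])

lemma otimes_add: "otimes (m + n) a = oadd (otimes m a) (otimes n a)"
  for a :: "'a::infinite ordinal"
  by (induction n) (simp_all add: oadd_assoc)

text \<open>The supremum of the finite ordinals is itself closed under successors, so the least such
  ordinal cannot exceed it; an induction puts every finite ordinal below
  \<open>omega\<close>.\<close>

lemma less_omega_iff: "x < omega \<longleftrightarrow> (\<exists>n. x = (osuc ^^ n) 0)" for x :: "'a::infinite ordinal"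
proof -
  define P where "P c \<longleftrightarrow> 0 < c \<and> (\<forall>a<c. osuc a < c)" for c :: "'a ordinal"
  let ?f = "\<lambda>n. (osuc ^^ n) (0 :: 'a ordinal)"
  have mem: "?f n < c" if "P c" for c n
    using that by (induction n) (auto simp: P_def)
  define s where "s = osup (range ?f)"
  have s: "x < s \<longleftrightarrow> (\<exists>n. x < ?f n)" for x
    unfolding s_def by (simp add: less_osup_iff small_range_nat)
  have "P s"
    unfolding P_def
  proof (intro conjI allI impI)
    show "0 < s"
      unfolding s by (rule exI[of _ 1]) simp
  next
    fix a assume "a < s"
    then obtain n where "a < ?f n"
      unfolding s by blast
    then have "osuc a < ?f (Suc n)"
      by simp
    then show "osuc a < s"
      unfolding s by blast
  qed
  then have "P omega" "omega \<le> s"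
    unfolding omega_def P_def[symmetric] by (auto intro: LeastI Least_le)
  have "\<exists>m. y = ?f m" if "y < ?f n" for y n
    using that by (induction n) (auto simp: le_less)
  then show ?thesis
    using mem[OF \<open>P omega\<close>] \<open>omega \<le> s\<close> s by (metis less_le_trans)
qed

lemma omult_0: "omult a 0 = 0" for a :: "'a::infinite ordinal"
  using less_omult_iff[of 0 a 0] by (simp add: zero_less_ordinal_iff)

lemma omult_mono_right: "b \<le> c \<Longrightarrow> omult a b \<le> omult a c" for a :: "'a::infinite ordinal"
  by (metis less_omult_iff less_irrefl less_le_trans not_le)

lemma omult_osuc: "omult a (osuc c) = oadd (omult a c) a" for a :: "'a::infinite ordinal"
proof -
  have "y < omult a (osuc c) \<longleftrightarrow> y < oadd (omult a c) a" for y
    unfolding less_omult_iff[of _ a "osuc c"]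
    by (metis less_osuc_iff omult_mono_right oadd_mono_left less_le_trans order_refl)
  then show ?thesis
    by (metis linorder_neqE less_irrefl)
qed

lemma omult_nat: "omult a ((osuc ^^ n) 0) = otimes n a" for a :: "'a::infinite ordinal"
  by (induction n) (simp_all add: omult_0 omult_osuc)

lemma less_omult_omega_iff: "y < omult a omega \<longleftrightarrow> (\<exists>n. y < otimes n a)"
  for a :: "'a::infinite ordinal"
proof -
  have "y < omult a omega \<longleftrightarrow> (\<exists>n. y < otimes (Suc n) a)"
    unfolding less_omult_iff[of _ a omega] less_omega_iff by (auto simp: omult_nat)
  also have "\<dots> \<longleftrightarrow> (\<exists>n. y < otimes n a)"
    by (metis otimes.simps(2) le_oadd_left less_le_trans)
  finally show ?thesis .
qed

text \<open>Multiplication by \<open>omega\<close> contributes only finite multiples, so general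
  ordinal multiplication disappears here. The disjunct \<open>y = 0\<close> accounts for
  \<open>b = 0\<close>.\<close>

lemma less_omega_pow_iff: "y < omega_pow b \<longleftrightarrow> y = 0 \<or> (\<exists>c<b. \<exists>n. y < otimes n (omega_pow c))"
  for b :: "'a::infinite ordinal"
  by (subst omega_pow.simps)
    (auto simp: less_osup_iff small_insert small_image small_lessThan less_omult_omega_iff
      intro: order_antisym)

lemma omega_pow_0: "omega_pow 0 = osuc (0 :: 'a::infinite ordinal)"
proof (rule order_antisym)
  have "osuc (0 :: 'a ordinal) \<noteq> 0"
    by (metis less_osuc_iff not_less_zero_ordinal order_refl)
  then show "omega_pow 0 \<le> osuc (0 :: 'a ordinal)"
    by (simp add: less_omega_pow_iff flip: not_less)
  show "osuc (0 :: 'a ordinal) \<le> omega_pow 0"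
    by (simp add: less_omega_pow_iff)
qed

lemma omega_pow_pos [simp]: "0 < omega_pow b" for b :: "'a::infinite ordinal"
  by (simp add: less_omega_pow_iff)

lemma otimes_omega_pow_less: "c < b \<Longrightarrow> otimes n (omega_pow c) < omega_pow b"
  for b :: "'a::infinite ordinal"
  unfolding less_omega_pow_iff[of _ b]
  by (metis omega_pow_pos oadd_0_right oadd_strict_mono otimes.simps(2))

lemma omega_pow_strict_mono: "strict_mono (omega_pow :: 'a::infinite ordinal \<Rightarrow> _)"
  by (rule strict_monoI) (use otimes_omega_pow_less[of _ _ 1] in simp)

lemmas omega_pow_less_iff [simp] = strict_mono_less[OF omega_pow_strict_mono]
  and omega_pow_le_iff [simp] = strict_mono_less_eq[OF omega_pow_strict_mono]

text \<open>Both summands lie below finite multiples of one common smaller power, and a sum of two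
  finite multiples is again one.\<close>

lemma omega_pow_indecomposable: "x < omega_pow b \<Longrightarrow> y < omega_pow b \<Longrightarrow> oadd x y < omega_pow b"
  for b :: "'a::infinite ordinal"
proof (cases "x = 0 \<or> y = 0")
  case False
  assume "x < omega_pow b" "y < omega_pow b"
  with False obtain c m d n where cd: "c < b" "d < b"
    and x: "x < otimes m (omega_pow c)" and y: "y < otimes n (omega_pow d)"
    unfolding less_omega_pow_iff[of _ b] by blast
  define e where "e = max c d"
  have x': "x < otimes m (omega_pow e)"
    using x by (rule less_le_trans) (simp add: e_def otimes_mono_right)
  have y': "y < otimes n (omega_pow e)"
    using y by (rule less_le_trans) (simp add: e_def otimes_mono_right)
  have "oadd x y < oadd (otimes m (omega_pow e)) (otimes n (omega_pow e))"
    using oadd_mono_left[OF less_imp_le[OF x']] oadd_strict_mono[OF y'] by (rule le_less_trans)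
  also have "\<dots> < omega_pow b"
    unfolding otimes_add[symmetric] using cd by (intro otimes_omega_pow_less) (simp add: e_def)
  finally show ?thesis .
qed auto

lemma le_omega_pow: "b \<le> omega_pow b" for b :: "'a::infinite ordinal"
proof (induction b rule: less_induct)
  case (less b)
  show ?case
  proof (rule ccontr)
    assume "\<not> b \<le> omega_pow b"
    then have "omega_pow b < b" by simp
    with less.IH[OF this] show False
      using omega_pow_less_iff[of "omega_pow b" b] by (simp flip: not_less)
  qed
qed

section \<open>Cantor normal forms\<close>

lemma cnf_val_empty [simp]: "cnf_val {#} = 0"
  by (simp add: cnf_val_def)

text \<open>The largest exponent gives the leading term. This is why inductions over normal forms
  build multisets by inserting maxima.\<close>

lemma cnf_val_add_mset_max:
  "\<forall>y\<in>#M. y \<le> b \<Longrightarrow> cnf_val (add_mset b M) = oadd (omega_pow b) (cnf_val M)"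
  by (simp add: cnf_val_def sorted_insort_is_snoc)

lemma cnf_val_less_omega_pow: "\<forall>y\<in>#M. y < b \<Longrightarrow> cnf_val M < omega_pow b"
  for b :: "'a::infinite ordinal"
  by (induction M rule: multiset_induct_max)
    (auto simp: cnf_val_add_mset_max omega_pow_indecomposable)

text \<open>An excess of \<open>M\<close> at some \<open>y\<close> must be compensated by an excess
  of \<open>N\<close> at a larger element, which is impossible above \<open>b\<close>.\<close>

lemma multiset_less_imp_bounded:
  fixes M N :: "'a::linorder multiset"
  assumes "M < N" "\<forall>y\<in>#N. y \<le> b"
  shows "\<forall>y\<in>#M. y \<le> b"
proof (rule ballI, rule ccontr)
  fix y assume "y \<in># M" "\<not> y \<le> b"
  then have "count N y < count M y"
    using assms(2) by (metis count_greater_zero_iff not_in_iff)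
  then obtain x where "y < x" "count M x < count N x"
    using assms(1) unfolding less_multiset\<^sub>H\<^sub>O by blast
  then have "x \<in># N"
    by (metis count_greater_zero_iff gr_implies_not0 gr0I)
  then have "x \<le> b" using assms(2) by blast
  with \<open>y < x\<close> \<open>\<not> y \<le> b\<close> show False by simp
qed

text \<open>Compare leading terms: if the maximum \<open>b\<close> of the larger multiset also
  occurs in \<open>M\<close>, it cancels on both sides; otherwise all exponents of \<open>M\<close>
  lie below \<open>b\<close>, and indecomposability keeps its value below
  \<open>omega_pow b\<close>.\<close>

lemma cnf_val_strict_mono: "M < N \<Longrightarrow> cnf_val M < cnf_val N" for M :: "'a::infinite ordinal multiset"
proof (induction N arbitrary: M rule: multiset_induct_max)
  case empty
  then show ?case by simp
next
  case (add b N)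
  have bd: "\<forall>y\<in>#M. y \<le> b"
    using multiset_less_imp_bounded[OF add.prems, of b] add.hyps by simp
  show ?case
  proof (cases "b \<in># M")
    case True
    then obtain M' where M: "M = add_mset b M'"
      by (metis insert_DiffM)
    with add.prems have "M' < N" by simp
    from add.IH[OF this] show ?thesis
      using bd add.hyps by (simp add: M cnf_val_add_mset_max)
  next
    case False
    with bd have "\<forall>y\<in>#M. y < b"
      by (metis order_le_less)
    then have "cnf_val M < omega_pow b"
      by (rule cnf_val_less_omega_pow)
    also have "\<dots> \<le> cnf_val (add_mset b N)"
      using add.hyps by (simp add: cnf_val_add_mset_max)
    finally show ?thesis .
  qed
qed

lemma cnf_val_less_iff: "cnf_val M < cnf_val N \<longleftrightarrow> M < N" for M :: "'a::infinite ordinal multiset"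
  by (rule strict_mono_less[OF strict_monoI[OF cnf_val_strict_mono]])

lemma omega_pow_le_cnf_val: "b \<in># M \<Longrightarrow> omega_pow b \<le> cnf_val M" for b :: "'a::infinite ordinal"
proof -
  assume "b \<in># M"
  then have "\<not> M < {#b#}"
    by (auto simp: not_less)
  then show ?thesis
    using cnf_val_add_mset_max[of "{#}" b] by (simp flip: cnf_val_less_iff add: not_less)
qed

lemma cnf_val_replicate_add:
  "\<forall>y\<in>#R. y \<le> c \<Longrightarrow> cnf_val (replicate_mset n c + R) = oadd (otimes n (omega_pow c)) (cnf_val R)"
  for c :: "'a::infinite ordinal"
proof (induction n arbitrary: R)
  case (Suc n)
  have "cnf_val (replicate_mset (Suc n) c + R) = cnf_val (replicate_mset n c + add_mset c R)"
    by simp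
  also have "\<dots> = oadd (otimes n (omega_pow c)) (cnf_val (add_mset c R))"
    using Suc by (intro Suc.IH) auto
  finally show ?case
    using Suc.prems by (simp add: cnf_val_add_mset_max oadd_assoc)
qed simp

text \<open>Division with remainder: split off the largest multiple of the largest power of omega
  not exceeding \<open>x\<close>. The remainder is below that power, hence below \<open>x\<close>,
  and has a normal form by induction.\<close>

lemma surj_cnf_val: "\<exists>M. cnf_val M = x" for x :: "'a::infinite ordinal"
proof (induction x rule: less_induct)
  case (less x)
  show ?case
  proof (cases "x = 0")
    case True
    then show ?thesis by (metis cnf_val_empty)
  next
    case False
    \<comment> \<open>The exponent sought is not \<open>b\<close> itself: the description of the
      ordinals below \<open>omega_pow b\<close> yields \<open>c < b\<close> with a finite multiple
      of \<open>omega_pow c\<close> above \<open>x\<close>, and minimality of \<open>b\<close> gives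
      \<open>omega_pow c \<le> x\<close>.\<close>
    define b where "b = (LEAST b. x < omega_pow b)"
    have "x < omega_pow (osuc x)"
      by (rule less_le_trans[OF _ le_omega_pow]) simp
    then have "x < omega_pow b"
      unfolding b_def by (rule LeastI)
    with False obtain c n where c: "c < b" "x < otimes n (omega_pow c)"
      unfolding less_omega_pow_iff[of _ b] by blast
    have cx: "omega_pow c \<le> x"
      using not_less_Least[where P = "\<lambda>b. x < omega_pow b"] c(1) unfolding b_def by force
    define m where "m = (LEAST n. x < otimes n (omega_pow c))"
    have xm: "x < otimes m (omega_pow c)"
      unfolding m_def by (rule LeastI[of _ n]) (fact c)
    then obtain k where m: "m = Suc k"
      by (cases m) auto
    have "otimes k (omega_pow c) \<le> x"
      using not_less_Least[where P = "\<lambda>n. x < otimes n (omega_pow c)", of k] m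
      unfolding m_def by force
    then obtain r where r: "x = oadd (otimes k (omega_pow c)) r"
      using le_imp_oadd by blast
    with xm have rc: "r < omega_pow c"
      by (simp add: m)
    with cx have "r < x" by (rule less_le_trans[rotated])
    then obtain R where R: "cnf_val R = r"
      using less by blast
    have "\<forall>y\<in>#R. y \<le> c"
      using omega_pow_le_cnf_val[of _ R] rc unfolding R
      by (metis le_less_trans less_imp_le omega_pow_less_iff)
    then have "cnf_val (replicate_mset k c + R) = x"
      by (simp add: cnf_val_replicate_add r R)
    then show ?thesis ..
  qed
qed

lemma cnf_cnf_val [simp]: "cnf (cnf_val M) = M" for M :: "'a::infinite ordinal multiset"
  unfolding cnf_def by (rule the_equality) (metis cnf_val_less_iff less_irrefl linorder_neqE)+

lemma cnf_val_cnf [simp]: "cnf_val (cnf x) = x" for x :: "'a::infinite ordinal"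
  using surj_cnf_val[of x] by auto

lemma cnf_less_iff: "cnf x < cnf y \<longleftrightarrow> x < y" for x :: "'a::infinite ordinal"
  by (simp flip: cnf_val_less_iff)

lemma cnf_inject [simp]: "cnf x = cnf y \<longleftrightarrow> x = y" for x :: "'a::infinite ordinal"
  by (metis cnf_val_cnf)

lemma cnf_0 [simp]: "cnf (0 :: 'a::infinite ordinal) = {#}"
  by (metis cnf_cnf_val cnf_val_empty)

lemma less_omega_pow_cnf: "x < omega_pow b \<longleftrightarrow> (\<forall>e\<in>#cnf x. e < b)" for b :: "'a::infinite ordinal"
  using cnf_val_less_omega_pow[of "cnf x" b] omega_pow_le_cnf_val[of _ "cnf x"]
  by (metis cnf_val_cnf le_less_trans omega_pow_less_iff)

section \<open>The ordered semiring of ordinals under the natural operations\<close>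

text \<open>Monotonicity of multiplication does not suffice to order the ring of differences: \<open>b < a\<close> does
  not make \<open>a\<close> the sum of \<open>b\<close> and a positive element (\<open>1 + x = \<omega>\<close> has no solution for the natural sum),
  so positivity of products of positive differences is required directly.\<close>

class ordered_diff_semiring = comm_semiring_1 + linordered_cancel_ab_semigroup_add +
  assumes cross_less: "b < a \<Longrightarrow> d < c \<Longrightarrow> a * d + b * c < a * c + b * d"

text \<open>Multiplication of formal sums of monomials, each monomial recorded by its exponent, as
  for polynomials with natural coefficients.\<close>

definition mset_conv :: "'a::plus multiset \<Rightarrow> 'a multiset \<Rightarrow> 'a multiset" where
  "mset_conv M N = (\<Sum>x\<in>#M. {#x + y. y \<in># N#})"

lemma mset_conv_empty [simp]: "mset_conv {#} N = {#}" "mset_conv M {#} = {#}"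
  by (simp_all add: mset_conv_def)

lemma mset_conv_add_left: "mset_conv (M + M') N = mset_conv M N + mset_conv M' N"
  by (simp add: mset_conv_def)

lemma mset_conv_add_mset_left: "mset_conv (add_mset x M) N = image_mset ((+) x) N + mset_conv M N"
  by (simp add: mset_conv_def)

lemma mset_conv_add_right: "mset_conv M (N + N') = mset_conv M N + mset_conv M N'"
  by (induction M) (simp_all add: mset_conv_add_mset_left ac_simps)

lemma mset_conv_singleton_left: "mset_conv {#x#} N = image_mset ((+) x) N"
  by (simp add: mset_conv_def)

lemma mset_conv_commute: "mset_conv M N = mset_conv N M" for M :: "'a::ab_semigroup_add multiset"
proof (induction M)
  case (add x M)
  have "mset_conv N {#x#} = image_mset ((+) x) N"
    by (induction N) (simp_all add: mset_conv_add_mset_left add.commute)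
  then show ?case
    using add mset_conv_add_right[of N "{#x#}" M] by (simp add: mset_conv_add_mset_left)
qed simp

lemma mset_conv_assoc: "mset_conv (mset_conv M N) K = mset_conv M (mset_conv N K)"
  for M :: "'a::ab_semigroup_add multiset"
proof (induction M)
  case (add x M)
  have "(+) (x + y) = (\<lambda>z. x + (y + z))" for y
    by (simp add: fun_eq_iff add.assoc)
  then have "mset_conv (image_mset ((+) x) N) K = image_mset ((+) x) (mset_conv N K)"
    by (induction N) (simp_all add: mset_conv_add_mset_left multiset.map_comp comp_def)
  with add show ?case
    by (simp add: mset_conv_add_mset_left mset_conv_add_left)
qed simp

lemma set_mset_conv: "set_mset (mset_conv M N) = {x + y |x y. x \<in># M \<and> y \<in># N}"
  by (induction M) (auto simp: mset_conv_add_mset_left)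

text \<open>In a linear order one element, the maximum of \<open>J\<close>, dominates everything
  that \<open>M\<close> has instead of \<open>J\<close>.\<close>

lemma less_multiset_dominated:
  fixes M N :: "'a::linorder multiset"
  assumes "M < N"
  obtains I J L j where "N = I + J" "M = I + L" "j \<in># J" "\<forall>x\<in>#J. x \<le> j" "\<forall>x\<in>#L. x < j"
proof -
  obtain I J L where *: "N = I + J" "M = I + L" "J \<noteq> {#}" "\<forall>k\<in>#L. \<exists>x\<in>#J. k < x"
    using multp_implies_one_step[OF transp_on_less] assms unfolding less_multiset_def by blast
  moreover have "\<forall>k\<in>#L. k < Max_mset J"
    using *(4) by (meson Max_ge finite_set_mset less_le_trans)
  ultimately show thesis
    using that[of I J L "Max_mset J"] by simp
qed

text \<open>After cancelling common parts, the largest exponent on the right-hand side is the sum of the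
  two leading exponents; it exceeds every exponent on the left-hand side.\<close>

lemma mset_conv_cross_less:
  fixes M N K L :: "'a::linordered_cancel_ab_semigroup_add multiset"
  assumes "N < M" "L < K"
  shows "mset_conv M L + mset_conv N K < mset_conv M K + mset_conv N L"
proof -
  obtain I A B a where 1: "M = I + A" "N = I + B" "a \<in># A" "\<forall>x\<in>#A. x \<le> a" "\<forall>x\<in>#B. x < a"
    using assms(1) by (rule less_multiset_dominated)
  obtain J C D c where 2: "K = J + C" "L = J + D" "c \<in># C" "\<forall>x\<in>#C. x \<le> c" "\<forall>x\<in>#D. x < c"
    using assms(2) by (rule less_multiset_dominated)
  have "a + c \<in># mset_conv A C"
    using 1 2 by (auto simp: set_mset_conv)
  moreover have "\<forall>k\<in>#mset_conv A D + mset_conv B C. k < a + c"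
    using 1 2 by (auto simp: set_mset_conv intro: add_less_le_mono add_le_less_mono)
  ultimately have "multp (<) ({#} + (mset_conv A D + mset_conv B C))
    ({#} + (mset_conv A C + mset_conv B D))"
    by (intro one_step_implies_multp) auto
  then have "mset_conv A D + mset_conv B C < mset_conv A C + mset_conv B D"
    by (simp add: less_multiset_def)
  then show ?thesis
    by (simp add: 1 2 mset_conv_add_left mset_conv_add_right ac_simps)
qed

instantiation ordinal :: (infinite) linordered_cancel_ab_semigroup_add
begin

definition plus_ordinal_def: "a + b = a \<oplus> b" for a b :: "'a ordinal"

text \<open>The type class demands a difference with \<open>a + b - a = b\<close>. Multiset
  difference of the exponents supplies it, truncated where \<open>b\<close> is not a summand of
  \<open>a\<close>; it is not ordinal subtraction.\<close>

definition minus_ordinal_def: "a - b = cnf_val (cnf a - cnf b)" for a b :: "'a ordinal"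

lemma cnf_add [simp]: "cnf (a + b) = cnf a + cnf b" for a b :: "'a ordinal"
  by (simp add: plus_ordinal_def nat_sum_def)

lemma cnf_diff [simp]: "cnf (a - b) = cnf a - cnf b" for a b :: "'a ordinal"
  by (simp add: minus_ordinal_def)

instance
proof
  fix a b c :: "'a ordinal"
  show "a + b + c = a + (b + c)" "a + b = b + a" "a + b - a = b" "a - b - c = a - (b + c)"
    by (simp_all add: ac_simps diff_diff_add_mset flip: cnf_inject)
  show "a \<le> b \<Longrightarrow> c + a \<le> c + b"
    by (simp flip: not_less cnf_less_iff)
qed

end

instantiation ordinal :: (infinite) ordered_diff_semiring
begin

definition one_ordinal_def: "1 = (osuc 0 :: 'a ordinal)"

definition times_ordinal_def: "a * b = a \<otimes> b" for a b :: "'a ordinal"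

lemma cnf_mult [simp]: "cnf (a * b) = mset_conv (cnf a) (cnf b)" for a b :: "'a ordinal"
  by (simp add: times_ordinal_def nat_prod_def mset_conv_def plus_ordinal_def)

lemma cnf_1 [simp]: "cnf (1 :: 'a ordinal) = {#0#}"
proof -
  have "cnf_val {#0 :: 'a ordinal#} = 1"
    using cnf_val_add_mset_max[of "{#}" "0 :: 'a ordinal"]
    by (simp add: one_ordinal_def omega_pow_0)
  then show ?thesis
    by (metis cnf_cnf_val)
qed

instance
proof
  fix a b c :: "'a ordinal"
  show "0 + a = a"
    by (simp flip: cnf_inject)
  have "(+) (0 :: 'a ordinal) = id"
    by (auto simp: fun_eq_iff simp flip: cnf_inject)
  then show "1 * a = a"
    by (simp add: mset_conv_singleton_left flip: cnf_inject)
  show "a * b * c = a * (b * c)" "(a + b) * c = a * c + b * c"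
    by (simp_all add: mset_conv_assoc mset_conv_add_left flip: cnf_inject)
  show "a * b = b * a"
    using mset_conv_commute by (simp flip: cnf_inject)
  show "0 * a = 0" "a * 0 = 0"
    by (simp_all flip: cnf_inject)
  show "(0 :: 'a ordinal) \<noteq> 1"
    by (simp flip: cnf_inject)
  show "a * d + b * c < a * c + b * d" if "b < a" "d < c" for d
    using that by (simp add: mset_conv_cross_less flip: cnf_less_iff)
qed

end

lemma finite_less_omega_pow_1: "of_nat n < omega_pow (1 :: 'a::infinite ordinal)"
proof -
  have "cnf (of_nat n :: 'a ordinal) = replicate_mset n 0"
    by (induction n) simp_all
  then show ?thesis
    by (auto simp: less_omega_pow_cnf zero_less_ordinal_iff)
qed

context
  fixes \<alpha> :: "'a::infinite ordinal"
begin

lemma zero_in_N_car: "0 \<in> N_car \<alpha>"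
  by (simp add: N_car_def)

text \<open>Membership constrains only the exponents of the exponents. A natural sum unites the
  exponents and a natural product adds them, which unites their own exponents; both closure
  properties follow.\<close>

lemma N_car_iff: "x \<in> N_car \<alpha> \<longleftrightarrow> (\<forall>e\<in>#cnf x. \<forall>f\<in>#cnf e. f < \<alpha>)"
  by (simp add: N_car_def less_omega_pow_cnf)

lemma one_in_N_car: "1 \<in> N_car \<alpha>"
  by (simp add: N_car_iff)

lemma add_in_N_car: "x \<in> N_car \<alpha> \<Longrightarrow> y \<in> N_car \<alpha> \<Longrightarrow> x + y \<in> N_car \<alpha>"
  by (auto simp: N_car_iff)

lemma mult_in_N_car: "x \<in> N_car \<alpha> \<Longrightarrow> y \<in> N_car \<alpha> \<Longrightarrow> x * y \<in> N_car \<alpha>"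
  by (fastforce simp: N_car_iff set_mset_conv)

text \<open>This is where \<alpha> > 0 enters: for \<alpha> = 0 the bound of the carrier is omega
  itself.\<close>

lemma omega_pow_1_in_N_car: "\<alpha> > 0 \<Longrightarrow> omega_pow 1 \<in> N_car \<alpha>"
  unfolding N_car_def using omega_pow_less_iff[of 0 \<alpha>]
  by (simp add: omega_pow_0 one_ordinal_def)

end

section \<open>The ring of differences\<close>

definition diff_rel :: "'a::cancel_ab_semigroup_add \<times> 'a \<Rightarrow> 'a \<times> 'a \<Rightarrow> bool" where
  "diff_rel = (\<lambda>(a, b) (c, d). a + d = b + c)"

lemma equivp_diff_rel: "equivp (diff_rel :: 'a::cancel_ab_semigroup_add \<times> 'a \<Rightarrow> _)"
proof (rule equivpI)
  show "reflp (diff_rel :: 'a \<times> 'a \<Rightarrow> _)"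
    by (auto simp: reflp_def diff_rel_def add.commute)
  show "symp (diff_rel :: 'a \<times> 'a \<Rightarrow> _)"
    by (auto simp: symp_def diff_rel_def add.commute)
  show "transp (diff_rel :: 'a \<times> 'a \<Rightarrow> _)"
  proof (rule transpI, unfold split_paired_all)
    fix a b c d e f :: 'a
    assume "diff_rel (a, b) (c, d)" "diff_rel (c, d) (e, f)"
    then have "a + d + (c + f) = b + c + (d + e)"
      by (simp add: diff_rel_def)
    then have "(c + d) + (a + f) = (c + d) + (b + e)"
      by (simp add: ac_simps)
    then show "diff_rel (a, b) (e, f)"
      by (simp add: diff_rel_def)
  qed
qed

quotient_type (overloaded) 'a difference = "'a::ordered_diff_semiring \<times> 'a" / diff_rel
  by (rule equivp_diff_rel)

instantiation difference :: (ordered_diff_semiring) linordered_idom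
begin

lift_definition zero_difference :: "'a difference" is "(0, 0)" .

lift_definition one_difference :: "'a difference" is "(1, 0)" .

lift_definition plus_difference :: "'a difference \<Rightarrow> 'a difference \<Rightarrow> 'a difference"
  is "\<lambda>(a, b) (c, d). (a + c, b + d)"
  by (auto simp: diff_rel_def) (metis add.assoc add.left_commute)

lift_definition uminus_difference :: "'a difference \<Rightarrow> 'a difference" is "\<lambda>(a, b). (b, a)"
  by (auto simp: diff_rel_def)

definition minus_difference :: "'a difference \<Rightarrow> 'a difference \<Rightarrow> 'a difference" where
  "minus_difference x y = x + - y"

lift_definition times_difference :: "'a difference \<Rightarrow> 'a difference \<Rightarrow> 'a difference"
  is "\<lambda>(a, b) (c, d). (a * c + b * d, a * d + b * c)"
proof (clarsimp simp: diff_rel_def)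
  fix a b a' b' c d c' d' :: 'a
  assume 1: "a + b' = b + a'" and 2: "c + d' = d + c'"
  \<comment> \<open>\<open>?T\<close> collects mixed products of old and new representatives, so
    that every term can be grouped into a multiple of a side of one of the two hypotheses; it is
    cancelled at the end.\<close>
  let ?T = "b' * c + a' * d + a' * c + b' * d"
  have "?T + (a * c + b * d + (a' * d' + b' * c'))
      = (a + b') * c + (b + a') * d + a' * (c + d') + b' * (d + c')"
    by (simp add: algebra_simps)
  also have "\<dots> = (b + a') * c + (a + b') * d + a' * (d + c') + b' * (c + d')"
    by (simp only: 1 2)
  also have "\<dots> = ?T + (a * d + b * c + (a' * c' + b' * d'))"
    by (simp add: algebra_simps)
  finally show "a * c + b * d + (a' * d' + b' * c') = a * d + b * c + (a' * c' + b' * d')"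
    by (rule add_left_imp_eq)
qed

lift_definition less_eq_difference :: "'a difference \<Rightarrow> 'a difference \<Rightarrow> bool"
  is "\<lambda>(a, b) (c, d). a + d \<le> b + c"
proof (clarsimp simp: diff_rel_def)
  fix a b a' b' c d c' d' :: 'a
  assume 1: "a + b' = b + a'" and 2: "c + d' = d + c'"
  have "a + d \<le> b + c \<longleftrightarrow> (a + d) + (b' + d') \<le> (b + c) + (b' + d')"
    by simp
  also have "\<dots> \<longleftrightarrow> (a + b') + (d + d') \<le> (c + d') + (b + b')"
    by (simp add: ac_simps)
  also have "\<dots> \<longleftrightarrow> (a' + d') + (b + d) \<le> (b' + c') + (b + d)"
    unfolding 1 2 by (simp add: ac_simps)
  also have "\<dots> \<longleftrightarrow> a' + d' \<le> b' + c'"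
    by simp
  finally show "(a + d \<le> b + c) = (a' + d' \<le> b' + c')" .
qed

definition less_difference :: "'a difference \<Rightarrow> 'a difference \<Rightarrow> bool" where
  "less_difference x y \<longleftrightarrow> x \<le> y \<and> \<not> y \<le> x"

definition abs_if_difference: "\<bar>x\<bar> = (if x < 0 then - x else x)" for x :: "'a difference"

definition sgn_difference :: "'a difference \<Rightarrow> 'a difference" where
  "sgn_difference x = (if x = 0 then 0 else if 0 < x then 1 else - 1)"

lemma less_difference_iff: "x < y \<longleftrightarrow> \<not> y \<le> x" for x y :: "'a difference"
  unfolding less_difference_def
  by transfer (clarsimp, metis add.commute linear)

instance
proof
  fix x y z :: "'a difference"
  show "x * y * z = x * (y * z)" "x * y = y * x" "1 * x = x" "x + y + z = x + (y + z)" "x + y = y + x"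
    "0 + x = x" "- x + x = 0" "(x + y) * z = x * z + y * z"
    by (transfer; auto simp: diff_rel_def algebra_simps)+
  show "x - y = x + - y"
    by (simp add: minus_difference_def)
  show "x + y - x = y" "x - y - z = x - (y + z)"
    unfolding minus_difference_def by (transfer; auto simp: diff_rel_def ac_simps)+
  show "0 * x = 0" "x * 0 = 0"
    by (transfer; auto simp: diff_rel_def)+
  show "(0 :: 'a difference) \<noteq> 1"
    by transfer (simp add: diff_rel_def)
  show "x < y \<longleftrightarrow> x \<le> y \<and> \<not> y \<le> x"
    by (simp add: less_difference_def)
  show "x \<le> x"
    by transfer (auto simp: add.commute)
  show "x \<le> y \<or> y \<le> x"
    by transfer (clarsimp, metis add.commute linear)
  show "z + x \<le> z + y" if "x \<le> y"
    using that
  proof (transfer, clarsimp)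
    fix a b c d e f :: 'a
    assume "a + d \<le> b + c"
    then have "(e + f) + (a + d) \<le> (e + f) + (b + c)"
      by simp
    then show "e + a + (f + d) \<le> f + b + (e + c)"
      by (simp add: ac_simps)
  qed
  show "x \<le> y \<Longrightarrow> y \<le> x \<Longrightarrow> x = y"
    by transfer (clarsimp simp: diff_rel_def, metis add.commute order_antisym)
  show "x \<le> z" if "x \<le> y" "y \<le> z"
    using that
  proof (transfer, clarify)
    fix a b c d e f :: 'a
    assume "a + d \<le> b + c" "c + f \<le> d + e"
    then have "(a + d) + (c + f) \<le> (b + c) + (d + e)"
      by (rule add_mono)
    then have "(c + d) + (a + f) \<le> (c + d) + (b + e)"
      by (simp add: ac_simps)
    then show "a + f \<le> b + e"
      by simp
  qed
  \<comment> \<open>Here \<open>cross_less\<close> is needed: the claim is positivity of the product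
    of the positive differences \<open>y - x\<close> and \<open>z\<close>.\<close>
  show "z * x < z * y" if "x < y" "0 < z"
    using that unfolding less_difference_iff
  proof (transfer, clarsimp simp: not_le)
    fix a b c d e f :: 'a
    assume "b + c < a + d" "f < e"
      and "e * a + f * b + (e * d + f * c) \<le> e * b + f * a + (e * c + f * d)"
    then show False
      using cross_less[of "b + c" "a + d" f e] by (simp add: algebra_simps)
  qed
  show "\<bar>x\<bar> = (if x < 0 then - x else x)"
    by (rule abs_if_difference)
  show "sgn x = (if x = 0 then 0 else if 0 < x then 1 else - 1)"
    by (simp add: sgn_difference_def)
qed

end

lift_definition Diff :: "'a \<Rightarrow> 'a \<Rightarrow> 'a::ordered_diff_semiring difference" is Pair .

lemma Diff_eq_iff: "Diff a b = Diff c d \<longleftrightarrow> a + d = b + c"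
  by transfer (simp add: diff_rel_def)

lemma Diff_le_iff: "Diff a b \<le> Diff c d \<longleftrightarrow> a + d \<le> b + c"
  by transfer simp

lemma Diff_add: "Diff a b + Diff c d = Diff (a + c) (b + d)"
  by transfer (simp add: diff_rel_def ac_simps)

lemma Diff_mult: "Diff a b * Diff c d = Diff (a * c + b * d) (a * d + b * c)"
  by transfer (simp add: diff_rel_def ac_simps)

lemma Diff_minus: "- Diff a b = Diff b a"
  by transfer (simp add: diff_rel_def ac_simps)

lemma zero_Diff: "0 = Diff 0 0"
  by transfer (simp add: diff_rel_def)

lemma one_Diff: "1 = Diff 1 0"
  by transfer (simp add: diff_rel_def)

lemma of_nat_Diff: "of_nat n = Diff (of_nat n) 0"
  by (induction n) (simp_all add: zero_Diff one_Diff Diff_add)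

lemma zero_le_Fract_iff_mult: "b \<noteq> 0 \<Longrightarrow> 0 \<le> Fract a b \<longleftrightarrow> 0 \<le> a * b"
  by (simp add: Zero_fract_def)

text \<open>Reduces an operation on classes, defined as a union over representatives, to
  independence of the representatives and nonemptiness of the class.\<close>

lemma UN_pair_eq: "X \<noteq> {} \<Longrightarrow> (\<And>a b. (a, b) \<in> X \<Longrightarrow> f a b = C) \<Longrightarrow> (\<Union>(a, b)\<in>X. f a b) = C"
  by fastforce

section \<open>The field \<open>\<rat>\<^sub>\<alpha>\<close> as a subfield of a type of fractions\<close>

context
  fixes \<alpha> :: "'a::infinite ordinal"
begin

definition Z_dom :: "'a ordinal difference set" where
  "Z_dom = {Diff a b |a b. a \<in> N_car \<alpha> \<and> b \<in> N_car \<alpha>}"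

text \<open>The class of a difference cut down to pairs from the carrier. It is empty outside
  \<open>Z_dom\<close>, so injectivity needs a membership hypothesis on one side only.\<close>

definition Z_repr :: "'a ordinal difference \<Rightarrow> 'a zord" where
  "Z_repr z = {(a, b). a \<in> N_car \<alpha> \<and> b \<in> N_car \<alpha> \<and> Diff a b = z}"

lemma Diff_in_Z_dom: "a \<in> N_car \<alpha> \<Longrightarrow> b \<in> N_car \<alpha> \<Longrightarrow> Diff a b \<in> Z_dom"
  unfolding Z_dom_def by blast

lemma Z_domE:
  assumes "z \<in> Z_dom"
  obtains a b where "z = Diff a b" "a \<in> N_car \<alpha>" "b \<in> N_car \<alpha>"
  using assms unfolding Z_dom_def by blast

lemma Z_dom_closed:
  "0 \<in> Z_dom" "1 \<in> Z_dom"
  "x \<in> Z_dom \<Longrightarrow> y \<in> Z_dom \<Longrightarrow> x + y \<in> Z_dom"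
  "x \<in> Z_dom \<Longrightarrow> y \<in> Z_dom \<Longrightarrow> x * y \<in> Z_dom"
  "x \<in> Z_dom \<Longrightarrow> - x \<in> Z_dom"
  by (auto simp: zero_Diff one_Diff Diff_add Diff_mult Diff_minus elim!: Z_domE
      intro!: Diff_in_Z_dom zero_in_N_car one_in_N_car add_in_N_car mult_in_N_car)

lemma Z_repr_nonempty: "z \<in> Z_dom \<Longrightarrow> Z_repr z \<noteq> {}"
  by (auto simp: Z_dom_def Z_repr_def)

lemma Z_repr_inject: "x \<in> Z_dom \<Longrightarrow> Z_repr x = Z_repr y \<longleftrightarrow> x = y"
  using Z_repr_nonempty by (fastforce simp: Z_repr_def)

lemma Z_class_eq: "a \<in> N_car \<alpha> \<Longrightarrow> b \<in> N_car \<alpha> \<Longrightarrow> Z_class \<alpha> a b = Z_repr (Diff a b)"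
  by (auto simp: Z_class_def Z_rel_def Z_repr_def Diff_eq_iff ac_simps simp flip: plus_ordinal_def)

lemma Z_car_eq: "Z_car \<alpha> = Z_repr ` Z_dom"
proof -
  have "Z_car \<alpha> = (\<lambda>(a, b). Z_class \<alpha> a b) ` (N_car \<alpha> \<times> N_car \<alpha>)"
    by (auto simp: Z_car_def quotient_def Z_class_def)
  also have "\<dots> = (\<lambda>(a, b). Z_repr (Diff a b)) ` (N_car \<alpha> \<times> N_car \<alpha>)"
    by (rule image_cong) (auto simp: Z_class_eq)
  also have "\<dots> = Z_repr ` Z_dom"
    by (auto elim!: Z_domE intro: Diff_in_Z_dom)
  finally show ?thesis .
qed

lemma Z_zero_eq: "Z_zero \<alpha> = Z_repr 0"
  by (simp add: Z_zero_def Z_class_eq zero_in_N_car zero_Diff)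

lemma Z_add_eq:
  assumes "x \<in> Z_dom" "y \<in> Z_dom"
  shows "Z_add \<alpha> (Z_repr x) (Z_repr y) = Z_repr (x + y)"
  unfolding Z_add_def using assms
  by (intro UN_pair_eq Z_repr_nonempty)
    (auto simp: Z_repr_def Z_class_eq Diff_add add_in_N_car simp flip: plus_ordinal_def)

lemma Z_mult_eq:
  assumes "x \<in> Z_dom" "y \<in> Z_dom"
  shows "Z_mult \<alpha> (Z_repr x) (Z_repr y) = Z_repr (x * y)"
  unfolding Z_mult_def plus_ordinal_def[symmetric] times_ordinal_def[symmetric] using assms
  by (intro UN_pair_eq Z_repr_nonempty)
    (auto simp: Z_repr_def Z_class_eq Diff_mult add_in_N_car mult_in_N_car)

lemma Z_neg_eq: "x \<in> Z_dom \<Longrightarrow> Z_neg \<alpha> (Z_repr x) = Z_repr (- x)"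
  unfolding Z_neg_def
  by (intro UN_pair_eq Z_repr_nonempty) (auto simp: Z_repr_def Z_class_eq Diff_minus)

text \<open>The existential in the definition is harmless, since the comparison has the same truth
  value for all representatives.\<close>

lemma Z_le_eq: "x \<in> Z_dom \<Longrightarrow> y \<in> Z_dom \<Longrightarrow> Z_le (Z_repr x) (Z_repr y) \<longleftrightarrow> x \<le> y"
proof -
  assume "x \<in> Z_dom" "y \<in> Z_dom"
  then obtain a1 a2 b1 b2 where "(a1, a2) \<in> Z_repr y" "(b1, b2) \<in> Z_repr x"
    using Z_repr_nonempty by (metis ex_in_conv surj_pair)
  moreover have "a2 \<oplus> b1 \<le> a1 \<oplus> b2 \<longleftrightarrow> x \<le> y"
    if "(a1, a2) \<in> Z_repr y" "(b1, b2) \<in> Z_repr x" for a1 a2 b1 b2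
    using that by (auto simp: Z_repr_def Diff_le_iff add.commute simp flip: plus_ordinal_def)
  ultimately show ?thesis
    unfolding Z_le_def by blast
qed

section \<open>Fractions of differences with components in the carrier\<close>

definition Q_dom :: "'a ordinal difference fract set" where
  "Q_dom = {Fract a b |a b. a \<in> Z_dom \<and> b \<in> Z_dom \<and> b \<noteq> 0}"

definition Q_repr :: "'a ordinal difference fract \<Rightarrow> 'a qord" where
  "Q_repr q = {(Z_repr a, Z_repr b) |a b. a \<in> Z_dom \<and> b \<in> Z_dom \<and> b \<noteq> 0 \<and> Fract a b = q}"

lemma Fract_in_Q_dom: "a \<in> Z_dom \<Longrightarrow> b \<in> Z_dom \<Longrightarrow> b \<noteq> 0 \<Longrightarrow> Fract a b \<in> Q_dom"
  unfolding Q_dom_def by blast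

lemma Q_domE:
  assumes "q \<in> Q_dom"
  obtains a b where "q = Fract a b" "a \<in> Z_dom" "b \<in> Z_dom" "b \<noteq> 0"
  using assms unfolding Q_dom_def by blast

lemma Q_repr_nonempty: "q \<in> Q_dom \<Longrightarrow> Q_repr q \<noteq> {}"
  by (auto simp: Q_dom_def Q_repr_def)

lemma Q_repr_inject: "x \<in> Q_dom \<Longrightarrow> Q_repr x = Q_repr y \<longleftrightarrow> x = y"
proof
  assume "x \<in> Q_dom" "Q_repr x = Q_repr y"
  then obtain p q where "(p, q) \<in> Q_repr x" "(p, q) \<in> Q_repr y"
    using Q_repr_nonempty by (metis ex_in_conv surj_pair)
  then show "x = y"
    by (auto simp: Q_repr_def Z_repr_inject)
qed simp

lemma Q_pairs_eq: "Q_pairs \<alpha> = {(Z_repr a, Z_repr b) |a b. a \<in> Z_dom \<and> b \<in> Z_dom \<and> b \<noteq> 0}"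
  by (auto simp: Q_pairs_def Z_car_eq Z_zero_eq Z_repr_inject)

lemma Q_class_eq:
  assumes "a \<in> Z_dom" "b \<in> Z_dom" "b \<noteq> 0"
  shows "Q_class \<alpha> (Z_repr a) (Z_repr b) = Q_repr (Fract a b)"
proof -
  have "(Z_repr a, Z_repr b) \<in> Q_pairs \<alpha>"
    unfolding Q_pairs_eq using assms by blast
  then have "Q_class \<alpha> (Z_repr a) (Z_repr b) =
      {(c, d) \<in> Q_pairs \<alpha>. Z_mult \<alpha> (Z_repr a) d = Z_mult \<alpha> (Z_repr b) c}"
    by (auto simp: Q_class_def Q_rel_def)
  also have "\<dots> = {(Z_repr c, Z_repr d) |c d. c \<in> Z_dom \<and> d \<in> Z_dom \<and> d \<noteq> 0 \<and>
      Z_mult \<alpha> (Z_repr a) (Z_repr d) = Z_mult \<alpha> (Z_repr b) (Z_repr c)}"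
    unfolding Q_pairs_eq by auto
  also have "\<dots> = Q_repr (Fract a b)"
  proof -
    have "Z_mult \<alpha> (Z_repr a) (Z_repr d) = Z_mult \<alpha> (Z_repr b) (Z_repr c) \<longleftrightarrow> Fract c d = Fract a b"
      if "c \<in> Z_dom" "d \<in> Z_dom" "d \<noteq> 0" for c d
      using that assms by (auto simp: Z_mult_eq Z_repr_inject Z_dom_closed eq_fract mult.commute)
    then show ?thesis
      unfolding Q_repr_def by (simp cong: conj_cong)
  qed
  finally show ?thesis .
qed

lemma Q_car_eq: "Q_car \<alpha> = Q_repr ` Q_dom"
proof -
  have "Q_car \<alpha> = (\<lambda>(a, b). Q_class \<alpha> (Z_repr a) (Z_repr b)) ` (Z_dom \<times> (Z_dom - {0}))"
    by (auto simp: Q_car_def quotient_def Q_class_def Q_pairs_eq)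
  also have "\<dots> = (\<lambda>(a, b). Q_repr (Fract a b)) ` (Z_dom \<times> (Z_dom - {0}))"
    by (rule image_cong) (auto simp: Q_class_eq)
  also have "\<dots> = Q_repr ` Q_dom"
    by (auto elim!: Q_domE intro: Fract_in_Q_dom)
  finally show ?thesis .
qed

lemma Q_dom_closed:
  "0 \<in> Q_dom" "1 \<in> Q_dom"
  "x \<in> Q_dom \<Longrightarrow> y \<in> Q_dom \<Longrightarrow> x + y \<in> Q_dom"
  "x \<in> Q_dom \<Longrightarrow> - x \<in> Q_dom"
  "x \<in> Q_dom \<Longrightarrow> y \<in> Q_dom \<Longrightarrow> x - y \<in> Q_dom"
  "x \<in> Q_dom \<Longrightarrow> x / 2 \<in> Q_dom"
proof -
  show "0 \<in> Q_dom" "1 \<in> Q_dom"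
    unfolding Zero_fract_def One_fract_def by (intro Fract_in_Q_dom Z_dom_closed; simp)+
  show add: "x + y \<in> Q_dom" if "x \<in> Q_dom" "y \<in> Q_dom" for x y
    using that by (auto elim!: Q_domE intro!: Fract_in_Q_dom Z_dom_closed)
  show neg: "- x \<in> Q_dom" if "x \<in> Q_dom" for x
    using that by (auto elim!: Q_domE intro!: Fract_in_Q_dom Z_dom_closed)
  show "x - y \<in> Q_dom" if "x \<in> Q_dom" "y \<in> Q_dom"
    using add[OF that(1) neg[OF that(2)]] by simp
  show "x / 2 \<in> Q_dom" if "x \<in> Q_dom"
  proof -
    from that obtain a b where x: "x = Fract a b" "a \<in> Z_dom" "b \<in> Z_dom" "b \<noteq> 0"
      by (rule Q_domE)
    \<comment> \<open>Doubling the denominator halves \<open>x\<close> using only closure under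
      addition. Halves provide the midpoints for suprema and infima of balls.\<close>
    have "x = Fract a (b + b) + Fract a (b + b)"
      using x(4) by (simp add: x(1) eq_fract algebra_simps)
    then have "x / 2 = Fract a (b + b)"
      by simp
    moreover have "Fract a (b + b) \<in> Q_dom"
      using x by (intro Fract_in_Q_dom Z_dom_closed) auto
    ultimately show ?thesis
      by simp
  qed
qed

lemma Q_zero_eq: "Q_zero \<alpha> = Q_repr 0"
  using Q_class_eq[of 0 1] Z_class_eq[of 1 0] Z_dom_closed(1,2) one_in_N_car[of \<alpha>] zero_in_N_car[of \<alpha>]
  by (simp add: Q_zero_def Z_zero_eq Zero_fract_def flip: one_Diff one_ordinal_def)

lemma Q_add_eq:
  assumes "x \<in> Q_dom" "y \<in> Q_dom"
  shows "Q_add \<alpha> (Q_repr x) (Q_repr y) = Q_repr (x + y)"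
  unfolding Q_add_def using assms
  by (intro UN_pair_eq Q_repr_nonempty)
    (auto simp: Q_repr_def[of x] Q_repr_def[of y] Z_mult_eq Z_add_eq Z_dom_closed Q_class_eq ac_simps)

lemma Q_neg_eq: "x \<in> Q_dom \<Longrightarrow> Q_neg \<alpha> (Q_repr x) = Q_repr (- x)"
  unfolding Q_neg_def
  by (intro UN_pair_eq Q_repr_nonempty)
    (auto simp: Q_repr_def[of x] Z_neg_eq Z_dom_closed Q_class_eq)

lemma Q_diff_eq: "x \<in> Q_dom \<Longrightarrow> y \<in> Q_dom \<Longrightarrow> Q_diff \<alpha> (Q_repr x) (Q_repr y) = Q_repr (x - y)"
  by (simp add: Q_diff_def Q_neg_eq Q_add_eq Q_dom_closed)

lemma Q_nonneg_eq: "x \<in> Q_dom \<Longrightarrow> Q_nonneg \<alpha> (Q_repr x) \<longleftrightarrow> 0 \<le> x"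
proof -
  assume x: "x \<in> Q_dom"
  have "Z_le (Z_zero \<alpha>) (Z_mult \<alpha> p q) \<longleftrightarrow> 0 \<le> x" if "(p, q) \<in> Q_repr x" for p q
    using that
    by (auto simp: Q_repr_def Z_zero_eq Z_mult_eq Z_le_eq Z_dom_closed zero_le_Fract_iff_mult)
  then show ?thesis
    unfolding Q_nonneg_def using Q_repr_nonempty[OF x] by fastforce
qed

lemma Q_le_eq: "x \<in> Q_dom \<Longrightarrow> y \<in> Q_dom \<Longrightarrow> Q_le \<alpha> (Q_repr x) (Q_repr y) \<longleftrightarrow> x \<le> y"
  by (simp add: Q_le_def Q_diff_eq Q_nonneg_eq Q_dom_closed)

lemma Q_less_eq: "x \<in> Q_dom \<Longrightarrow> y \<in> Q_dom \<Longrightarrow> Q_less \<alpha> (Q_repr x) (Q_repr y) \<longleftrightarrow> x < y"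
  by (simp add: Q_less_def Q_le_eq Q_repr_inject less_le)

lemma Q_pos_eq: "Q_pos \<alpha> = Q_repr ` {q \<in> Q_dom. 0 < q}"
  by (auto simp: Q_pos_def Q_car_eq Q_zero_eq Q_less_eq Q_dom_closed)

lemma Q_abs_eq: "x \<in> Q_dom \<Longrightarrow> Q_abs \<alpha> (Q_repr x) = Q_repr \<bar>x\<bar>"
  by (simp add: Q_abs_def Q_nonneg_eq Q_neg_eq)

lemma Q_dom_abs: "x \<in> Q_dom \<Longrightarrow> \<bar>x\<bar> \<in> Q_dom"
  by (simp add: abs_if Q_dom_closed)

section \<open>Balls with their suprema and infima\<close>

lemma Q_ball_eq:
  "x \<in> Q_dom \<Longrightarrow> r \<in> Q_dom \<Longrightarrow> Q_ball \<alpha> (Q_repr x) (Q_repr r) = Q_repr ` {y \<in> Q_dom. \<bar>x - y\<bar> < r}"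
  by (auto simp: Q_ball_def Q_car_eq Q_diff_eq Q_abs_eq Q_less_eq Q_dom_closed Q_dom_abs)

lemma is_Q_sup_eq:
  "S \<subseteq> Q_dom \<Longrightarrow> s \<in> Q_dom \<Longrightarrow> is_Q_sup \<alpha> (Q_repr ` S) (Q_repr s) \<longleftrightarrow>
    (\<forall>x\<in>S. x \<le> s) \<and> (\<forall>u\<in>Q_dom. (\<forall>x\<in>S. x \<le> u) \<longrightarrow> s \<le> u)"
  by (simp add: is_Q_sup_def Q_car_eq Q_le_eq subset_iff)

lemma is_Q_inf_eq:
  "S \<subseteq> Q_dom \<Longrightarrow> i \<in> Q_dom \<Longrightarrow> is_Q_inf \<alpha> (Q_repr ` S) (Q_repr i) \<longleftrightarrow>
    (\<forall>x\<in>S. i \<le> x) \<and> (\<forall>l\<in>Q_dom. (\<forall>x\<in>S. l \<le> x) \<longrightarrow> l \<le> i)"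
  by (simp add: is_Q_inf_def Q_car_eq Q_le_eq subset_iff)

text \<open>An upper bound \<open>u\<close> below \<open>x + r\<close> is refuted by the midpoint of
  the two: \<open>u\<close> is at least the centre, so the midpoint still lies in the ball.\<close>

lemma sup_ball:
  assumes "x \<in> Q_dom" "r \<in> Q_dom" "0 < r"
  shows "is_Q_sup \<alpha> (Q_repr ` {y \<in> Q_dom. \<bar>x - y\<bar> < r}) (Q_repr (x + r))"
  unfolding is_Q_sup_eq[OF Collect_restrict Q_dom_closed(3)[OF assms(1,2)]]
proof (intro conjI ballI impI)
  fix u assume u: "u \<in> Q_dom" "\<forall>y\<in>{y \<in> Q_dom. \<bar>x - y\<bar> < r}. y \<le> u"
  show "x + r \<le> u"
  proof (rule ccontr)
    assume less: "\<not> x + r \<le> u"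
    have "x \<le> u"
      using u(2) assms by auto
    define y where "y = (u + (x + r)) / 2"
    have "y \<in> Q_dom"
      unfolding y_def using assms u(1) by (intro Q_dom_closed)
    moreover have "\<bar>x - y\<bar> < r" "u < y"
      using less \<open>x \<le> u\<close> by (auto simp: y_def abs_less_iff field_simps)
    ultimately show False
      using u(2) by auto
  qed
qed (auto simp: abs_less_iff)

lemma inf_ball:
  assumes "x \<in> Q_dom" "r \<in> Q_dom" "0 < r"
  shows "is_Q_inf \<alpha> (Q_repr ` {y \<in> Q_dom. \<bar>x - y\<bar> < r}) (Q_repr (x - r))"
  unfolding is_Q_inf_eq[OF Collect_restrict Q_dom_closed(5)[OF assms(1,2)]]
proof (intro conjI ballI impI)
  fix l assume l: "l \<in> Q_dom" "\<forall>y\<in>{y \<in> Q_dom. \<bar>x - y\<bar> < r}. l \<le> y"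
  show "l \<le> x - r"
  proof (rule ccontr)
    assume less: "\<not> l \<le> x - r"
    have "l \<le> x"
      using l(2) assms by auto
    define y where "y = (l + (x - r)) / 2"
    have "y \<in> Q_dom"
      unfolding y_def using assms l(1) by (intro Q_dom_closed)
    moreover have "\<bar>x - y\<bar> < r" "y < l"
      using less \<open>l \<le> x\<close> by (auto simp: y_def abs_less_iff field_simps)
    ultimately show False
      using l(2) by auto
  qed
qed (auto simp: abs_less_iff)

lemma Q_dom_infinite_element: "\<alpha> > 0 \<Longrightarrow> \<exists>w\<in>Q_dom. \<forall>n. of_nat n \<le> w"
proof -
  assume "\<alpha> > 0"
  let ?w = "Diff (omega_pow 1) (0 :: 'a ordinal)"
  have "Fract ?w 1 \<in> Q_dom"
    using \<open>\<alpha> > 0\<close>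
    by (intro Fract_in_Q_dom Diff_in_Z_dom Z_dom_closed omega_pow_1_in_N_car zero_in_N_car) simp_all
  moreover have "of_nat n \<le> Fract ?w 1" for n
    using finite_less_omega_pow_1[of n, where 'a = 'a]
    by (simp add: of_nat_fract of_nat_Diff Diff_le_iff less_imp_le)
  ultimately show ?thesis
    by blast
qed

end

section \<open>The cut between finite and positive infinite elements\<close>

theorem mainTheorem5:
  fixes \<alpha> :: "'a::infinite ordinal"
  assumes "\<alpha> > 0"
  shows "\<exists>(A, B) \<in> R_bar \<alpha>. improper \<alpha> (A, B) \<and> A \<noteq> {} \<and> B \<noteq> {}"
proof -
  let ?D = "Q_dom \<alpha>" and ?R = "Q_repr \<alpha>"
  define S where "S = {q \<in> ?D. \<exists>n. q < of_nat n}"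
  define T where "T = {q \<in> ?D. \<forall>n. of_nat n \<le> q}"
  have sub: "S \<subseteq> ?D" "T \<subseteq> ?D"
    by (auto simp: S_def T_def)
  \<comment> \<open>The two sides leave no gap, so the condition on elements outside both holds
    vacuously.\<close>
  have ST: "S \<union> T = ?D"
    by (auto simp: S_def T_def not_le)
  have less: "s < t" if "s \<in> S" "t \<in> T" for s t
    using that by (auto simp: S_def T_def intro: less_le_trans)
  have S1: "s + 1 \<in> S" if s: "s \<in> S" for s
  proof -
    obtain n where "s < of_nat n" using s unfolding S_def by blast
    then have "s + 1 < of_nat (Suc n)" by simp
    then show ?thesis
      using that Q_dom_closed(2,3) unfolding S_def by blast
  qed
  have T1: "t - 1 \<in> T" if "t \<in> T" for t
  proof -
    have "of_nat n \<le> t - 1" for n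
    proof -
      have "of_nat (Suc n) \<le> t" using that unfolding T_def by blast
      then show ?thesis by (simp add: algebra_simps)
    qed
    then show ?thesis
      using that Q_dom_closed(2,5) unfolding T_def by blast
  qed
  \<comment> \<open>With an empty side no ball would meet both, and the cut would be improper
    vacuously.\<close>
  have "0 \<in> S"
    using Q_dom_closed(1) by (auto simp: S_def intro: exI[of _ 1])
  have "T \<noteq> {}"
    using Q_dom_infinite_element[OF assms] by (auto simp: T_def)
  have "(?R ` S, ?R ` T) \<in> R_bar \<alpha>"
    unfolding R_bar_def
  proof (clarify, intro conjI ballI allI impI)
    show "?R ` S \<subseteq> Q_car \<alpha>" "?R ` T \<subseteq> Q_car \<alpha>"
      using sub by (auto simp: Q_car_eq)
    show "Q_less \<alpha> a b" if "a \<in> ?R ` S" "b \<in> ?R ` T" for a b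
      using that sub less by (auto simp: Q_less_eq subset_iff)
    show "x = y" if "x \<in> Q_car \<alpha> - (?R ` S \<union> ?R ` T)" for x y
      using that by (auto simp: Q_car_eq simp flip: ST)
    show "i \<notin> ?R ` T" if inf: "is_Q_inf \<alpha> (?R ` T) i" for i
    proof
      assume "i \<in> ?R ` T"
      then obtain t where t: "t \<in> T" "i = ?R t" by blast
      then have "t \<in> ?D" using sub by blast
      then have "\<forall>x\<in>T. t \<le> x"
        using inf sub t(2) by (simp add: is_Q_inf_eq)
      then have "t \<le> t - 1"
        using T1[OF t(1)] by blast
      then show False by simp
    qed
    show "s \<notin> ?R ` S" if sup: "is_Q_sup \<alpha> (?R ` S) s" for s
    proof
      assume "s \<in> ?R ` S"
      then obtain t where t: "t \<in> S" "s = ?R t" by blast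
      then have "t \<in> ?D" using sub by blast
      then have "\<forall>x\<in>S. x \<le> t"
        using sup sub t(2) by (simp add: is_Q_sup_eq)
      then have "t + 1 \<le> t"
        using S1[OF t(1)] by blast
      then show False by simp
    qed
    show "?R ` S \<inter> ?R ` T = {}"
      using sub less[THEN less_imp_neq] by (fastforce simp: Q_repr_inject)
  qed
  moreover have "improper \<alpha> (?R ` S, ?R ` T)"
    unfolding improper_def fst_conv snd_conv
  proof (intro bexI[of _ "?R 1"] allI impI)
    show "?R 1 \<in> Q_pos \<alpha>"
      unfolding Q_pos_eq by (rule imageI) (simp add: Q_dom_closed(2))
    fix U assume U: "is_Q_ball \<alpha> U \<and> U \<inter> ?R ` S \<noteq> {} \<and> U \<inter> ?R ` T \<noteq> {}"
    then obtain x r where xr: "x \<in> ?D" "r \<in> ?D" "0 < r" and "U = Q_ball \<alpha> (?R x) (?R r)"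
      unfolding is_Q_ball_def Q_car_eq Q_pos_eq by blast
    then have U_eq: "U = ?R ` {y \<in> ?D. \<bar>x - y\<bar> < r}"
      by (simp add: Q_ball_eq)
    have meet: "\<exists>v\<in>V. \<bar>x - v\<bar> < r" if "V \<subseteq> ?D" "U \<inter> ?R ` V \<noteq> {}" for V
      using that unfolding U_eq by (auto simp: Q_repr_inject subset_iff)
    obtain s t where st: "s \<in> S" "t \<in> T" "\<bar>x - s\<bar> < r" "\<bar>x - t\<bar> < r"
      using meet[OF sub(1)] meet[OF sub(2)] U by blast
    \<comment> \<open>\<open>s + 1\<close> still belongs to \<open>S\<close>, so
      \<open>t - s\<close> exceeds 1, while two points of the ball differ by less than
      \<open>2 * r\<close>, the distance between its supremum and infimum.\<close>
    have "s + 1 < t"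
      using less[OF S1] st by blast
    then have "1 < (x + r) - (x - r)"
      using st(3,4) by (auto simp: abs_less_iff)
    then have "Q_less \<alpha> (?R 1) (Q_diff \<alpha> (?R (x + r)) (?R (x - r)))"
      using xr by (simp only: Q_diff_eq Q_less_eq Q_dom_closed)
    then show "\<exists>s i. is_Q_sup \<alpha> U s \<and> is_Q_inf \<alpha> U i \<and> Q_less \<alpha> (?R 1) (Q_diff \<alpha> s i)"
      unfolding U_eq using sup_ball[OF xr] inf_ball[OF xr] by blast
  qed
  ultimately show ?thesis
    using \<open>0 \<in> S\<close> \<open>T \<noteq> {}\<close> by blast
qed

end
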